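(* Let $X$ and $Y$ be almost Hermitian orbifolds such that $X$ is cosymplectic and $Y$ is $(1,2)$-symplectic. Then any holomorphic complete orbifold map $\phi:X\to Y$ is harmonic.
   Context: An $n$-dimensional orbifold chart on a topological space $X$ is a triple $(\tilde U,\Gamma,\varphi)$ with $\tilde U\subset\mathbb{R}^n$ connected open, $\Gamma$ a finite group of diffeomorphisms of $\tilde U$, and $\varphi:\tilde U\to X$ a $\Gamma$-invariant map inducing a homeomorphism of $\tilde U/\Gamma$ onto an open subset of $X$. An embedding of charts $(\tilde U,\Gamma,\varphi)\to(\tilde V,\Delta,\psi)$ is a smooth embedding $\lambda:\tilde U\to\tilde V$ with $\psi\circ\lambda=\varphi$. A smooth orbifold is a Hausdorff paracompact space with a maximal atlas of locally compatible charts (around each common point of two chart domains there is a smaller chart embedding in both). A Riemannian (almost Hermitian) structure is a family of $\Gamma$-invariant Riemannian metrics (almost Hermitian structures) on the chart domains $\tilde U$, compatible with the embeddings of charts. A complete orbifold map $\phi:X\to Y$ is a continuous map together with a choice, near each point, of smooth local lifts $\tilde\phi:\tilde U\to\tilde V$ to orbifold charts, equivariant with respect to chosen group homomorphisms $\Gamma\to\Delta$ of the local groups, compatibly with changes of charts. It is holomorphic if the local lifts satisfy $d\tilde\phi\circ J^X=J^Y\circ d\tilde\phi$. It is harmonic if its tension field $\tau(\phi)=\mathrm{tr}(Dd\phi)$ vanishes, where $D$ is induced by the Levi-Civita connections (i.e. the tension fields of the local lifts vanish). On an almost Hermitian manifold (and, chart by chart, on an almost Hermitian orbifold) $(N,h,J)$,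 let $T^{\mathbb C}=T^{1,0}\oplus T^{0,1}$ be the splitting of the complexified tangent bundle into $\pm i$-eigenbundles of $J$, and let $F$ be the fundamental 2-vector defined by $h(F,X\wedge Y)=h(JX,Y)$. Identify $T^*$ with $T$ by $h$, and let $D_2F$ be the component of $\nabla F$ ($\nabla$ the Levi-Civita connection) in $(T^{1,0}\otimes\bigwedge^2T^{0,1})\oplus(T^{0,1}\otimes\bigwedge^2T^{1,0})$. The structure is $(1,2)$-symplectic if $D_2F=0$ and cosymplectic if $\mathrm{tr}(D_2F)=0$, where $\mathrm{tr}$ is the $h$-contraction of the derivative slot with the 2-vector (equivalently, the Kähler form is coclosed). *)

theory Defs
  imports "HOL-Analysis.Analysis" "HOL-Algebra.Group_Action"
begin

section \<open>Smooth maps and topological preliminaries\<close>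

primrec Ck_on :: "nat \<Rightarrow> 'a set \<Rightarrow> ('a::real_normed_vector \<Rightarrow> 'b::real_normed_vector) \<Rightarrow> bool"
  where
    "Ck_on 0 S f \<longleftrightarrow> continuous_on S f"
  | "Ck_on (Suc k) S f \<longleftrightarrow>
       (\<forall>x\<in>S. f differentiable (at x)) \<and> (\<forall>v. Ck_on k S (\<lambda>x. frechet_derivative f (at x) v))"

text \<open>Used only for open sets \<open>S\<close> in finite-dimensional spaces, where the recursion over
  directional derivatives describes the usual class of \<open>k\<close> times continuously differentiable maps.\<close>

definition smooth_on :: "'a set \<Rightarrow> ('a::real_normed_vector \<Rightarrow> 'b::real_normed_vector) \<Rightarrow> bool"
  where "smooth_on S f \<longleftrightarrow> (\<forall>k. Ck_on k S f)"

definition smooth_embedding ::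
    "'a::euclidean_space set \<Rightarrow> 'b::euclidean_space set \<Rightarrow> ('a \<Rightarrow> 'b) \<Rightarrow> bool"
  where "smooth_embedding U V f \<longleftrightarrow>
    f ` U \<subseteq> V \<and> smooth_on U f \<and> (\<forall>x\<in>U. inj (frechet_derivative f (at x))) \<and>
    embedding_map (top_of_set U) (top_of_set V) f"

definition paracompact_space :: "'a topology \<Rightarrow> bool"
  where "paracompact_space X \<longleftrightarrow>
    (\<forall>\<U>. (\<forall>U\<in>\<U>. openin X U) \<and> \<Union>\<U> = topspace X \<longrightarrow>
      (\<exists>\<V>. (\<forall>V\<in>\<V>. openin X V) \<and> \<Union>\<V> = topspace X \<and> (\<forall>V\<in>\<V>. \<exists>U\<in>\<U>. V \<subseteq> U) \<and>
        locally_finite_in X \<V>))"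

definition quotient_topology :: "'a topology \<Rightarrow> ('a \<Rightarrow> 'b) \<Rightarrow> 'b topology"
  where "quotient_topology X q =
    topology (\<lambda>W. W \<subseteq> q ` topspace X \<and> openin X {x \<in> topspace X. q x \<in> W})"

lemma openin_quotient_topology:
  "openin (quotient_topology X q) W \<longleftrightarrow>
     W \<subseteq> q ` topspace X \<and> openin X {x \<in> topspace X. q x \<in> W}"
proof -
  have "istopology (\<lambda>W. W \<subseteq> q ` topspace X \<and> openin X {x \<in> topspace X. q x \<in> W})"
    unfolding istopology_def
  proof (intro conjI allI impI)
    fix S T
    assume "S \<subseteq> q ` topspace X \<and> openin X {x \<in> topspace X. q x \<in> S}"
      and "T \<subseteq> q ` topspace X \<and> openin X {x \<in> topspace X. q x \<in> T}"
    moreover have "{x \<in> topspace X. q x \<in> S \<inter> T} =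
        {x \<in> topspace X. q x \<in> S} \<inter> {x \<in> topspace X. q x \<in> T}" by auto
    ultimately show "openin X {x \<in> topspace X. q x \<in> S \<inter> T}" by auto
  next
    fix \<K> assume K: "\<forall>K\<in>\<K>. K \<subseteq> q ` topspace X \<and> openin X {x \<in> topspace X. q x \<in> K}"
    have "{x \<in> topspace X. q x \<in> \<Union>\<K>} = (\<Union>K\<in>\<K>. {x \<in> topspace X. q x \<in> K})" by auto
    then show "openin X {x \<in> topspace X. q x \<in> \<Union>\<K>}" using K by auto
  qed blast+
  then show ?thesis by (simp add: quotient_topology_def)
qed

lemma quotient_map_quotient_topology:
  "quotient_map X (quotient_topology X q) q"
proof -
  have "topspace (quotient_topology X q) = q ` topspace X"
  proof
    show "topspace (quotient_topology X q) \<subseteq> q ` topspace X"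
      using openin_quotient_topology[of X q] by (metis openin_topspace)
    have "{x \<in> topspace X. q x \<in> q ` topspace X} = topspace X" by auto
    then have "openin (quotient_topology X q) (q ` topspace X)"
      by (simp add: openin_quotient_topology)
    then show "q ` topspace X \<subseteq> topspace (quotient_topology X q)"
      by (rule openin_subset)
  qed
  then show ?thesis by (auto simp: quotient_map_def openin_quotient_topology)
qed


section \<open>Orbifolds\<close>

record ('a, 'n) orbifold_chart =
  chart_dom :: "(real^'n) set"
  chart_group :: "(real^'n \<Rightarrow> real^'n) set"
  chart_map :: "real^'n \<Rightarrow> 'a"

text \<open>The elements of \<open>BijGroup U\<close> are extensional on \<open>U\<close>; likewise chart maps are taken
  extensional, so that equality of records is equality of charts.\<close>

definition local_group :: "('a, 'n::finite) orbifold_chart \<Rightarrow> (real^'n \<Rightarrow> real^'n) monoid"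
  where "local_group C = (BijGroup (chart_dom C)) \<lparr>carrier := chart_group C\<rparr>"

definition chart_orbit :: "('a, 'n::finite) orbifold_chart \<Rightarrow> real^'n \<Rightarrow> (real^'n) set"
  where "chart_orbit C = orbit (local_group C) (\<lambda>\<gamma>. \<gamma>)"

definition orbit_space :: "('a, 'n::finite) orbifold_chart \<Rightarrow> (real^'n) set topology"
  where "orbit_space C = quotient_topology (top_of_set (chart_dom C)) (chart_orbit C)"

definition chart_image :: "('a, 'n::finite) orbifold_chart \<Rightarrow> 'a set"
  where "chart_image C = chart_map C ` chart_dom C"

definition orbifold_chart :: "'a topology \<Rightarrow> ('a, 'n::finite) orbifold_chart \<Rightarrow> bool"
  where "orbifold_chart X C \<longleftrightarrow>
    open (chart_dom C) \<and> connected (chart_dom C) \<and>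
    finite (chart_group C) \<and> subgroup (chart_group C) (BijGroup (chart_dom C)) \<and>
    (\<forall>\<gamma>\<in>chart_group C. smooth_on (chart_dom C) \<gamma>) \<and>
    chart_map C \<in> chart_dom C \<rightarrow>\<^sub>E topspace X \<and>
    (\<forall>\<gamma>\<in>chart_group C. \<forall>x\<in>chart_dom C. chart_map C (\<gamma> x) = chart_map C x) \<and>
    openin X (chart_image C) \<and>
    (\<exists>f. (\<forall>x\<in>chart_dom C. f (chart_orbit C x) = chart_map C x) \<and>
         homeomorphic_map (orbit_space C) (subtopology X (chart_image C)) f)"

definition chart_embedding ::
    "('a, 'n::finite) orbifold_chart \<Rightarrow> ('a, 'n) orbifold_chart \<Rightarrow> (real^'n \<Rightarrow> real^'n) \<Rightarrow> bool"
  where "chart_embedding C D \<iota> \<longleftrightarrow>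
    smooth_embedding (chart_dom C) (chart_dom D) \<iota> \<and>
    (\<forall>x\<in>chart_dom C. chart_map D (\<iota> x) = chart_map C x)"

definition locally_compatible ::
    "'a topology \<Rightarrow> ('a, 'n::finite) orbifold_chart \<Rightarrow> ('a, 'n) orbifold_chart \<Rightarrow> bool"
  where "locally_compatible X C D \<longleftrightarrow>
    (\<forall>p \<in> chart_image C \<inter> chart_image D. \<exists>E \<iota>1 \<iota>2. orbifold_chart X E \<and> p \<in> chart_image E \<and>
       chart_embedding E C \<iota>1 \<and> chart_embedding E D \<iota>2)"

definition orbifold_atlas :: "'a topology \<Rightarrow> ('a, 'n::finite) orbifold_chart set \<Rightarrow> bool"
  where "orbifold_atlas X \<A> \<longleftrightarrow>
    (\<forall>C\<in>\<A>. orbifold_chart X C) \<and> (\<Union>C\<in>\<A>. chart_image C) = topspace X \<and>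
    (\<forall>C\<in>\<A>. \<forall>D\<in>\<A>. locally_compatible X C D)"

definition orbifold :: "'a topology \<Rightarrow> ('a, 'n::finite) orbifold_chart set \<Rightarrow> bool"
  where "orbifold X \<A> \<longleftrightarrow>
    Hausdorff_space X \<and> paracompact_space X \<and> orbifold_atlas X \<A> \<and>
    (\<forall>\<B>. orbifold_atlas X \<B> \<and> \<A> \<subseteq> \<B> \<longrightarrow> \<B> = \<A>)"


section \<open>Riemannian and almost Hermitian geometry on open subsets of Euclidean space\<close>

text \<open>A metric is a function of a point and two tangent vectors, an almost complex structure
  a function of a point and one tangent vector.\<close>

type_synonym 'n metric_field = "real^'n \<Rightarrow> real^'n \<Rightarrow> real^'n \<Rightarrow> real"
type_synonym 'n endo_field = "real^'n \<Rightarrow> real^'n \<Rightarrow> real^'n"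

definition riemannian_metric_on :: "(real^'n) set \<Rightarrow> 'n::finite metric_field \<Rightarrow> bool"
  where "riemannian_metric_on U g \<longleftrightarrow>
    (\<forall>x\<in>U. bilinear (g x) \<and> (\<forall>u v. g x u v = g x v u) \<and> (\<forall>v. v \<noteq> 0 \<longrightarrow> 0 < g x v v)) \<and>
    (\<forall>u v. smooth_on U (\<lambda>x. g x u v))"

definition almost_complex_structure_on :: "(real^'n) set \<Rightarrow> 'n::finite endo_field \<Rightarrow> bool"
  where "almost_complex_structure_on U J \<longleftrightarrow>
    (\<forall>x\<in>U. linear (J x) \<and> (\<forall>v. J x (J x v) = - v)) \<and> (\<forall>v. smooth_on U (\<lambda>x. J x v))"

definition almost_hermitian_on :: "(real^'n) set \<Rightarrow> 'n::finite metric_field \<Rightarrow> 'n endo_field \<Rightarrow> bool"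
  where "almost_hermitian_on U h J \<longleftrightarrow>
    riemannian_metric_on U h \<and> almost_complex_structure_on U J \<and>
    (\<forall>x\<in>U. \<forall>u v. h x (J x u) (J x v) = h x u v)"

lemma represent_linear:
  fixes b :: "real^'n \<Rightarrow> real^'n \<Rightarrow> real"
  assumes b: "bilinear b" and pos: "\<And>v. v \<noteq> 0 \<Longrightarrow> 0 < b v v" and \<alpha>: "linear \<alpha>"
  shows "\<exists>!w. \<forall>z. b w z = \<alpha> z"
proof -
  define T where "T w = (\<chi> i. b w (axis i 1))" for w
  have eqI: "\<beta> = \<gamma>" if "linear \<beta>" "linear \<gamma>" "\<And>i. \<beta> (axis i 1) = \<gamma> (axis i 1)"
    for \<beta> \<gamma> :: "real^'n \<Rightarrow> real"
    by (rule linear_eq_stdbasis) (use that in \<open>auto simp: Basis_vec_def\<close>)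
  have lin_b: "linear (b w)" for w using b by (simp add: bilinear_def)
  have linT: "linear T"
    by (rule linearI) (auto simp: T_def vec_eq_iff bilinear_ladd[OF b] bilinear_lmul[OF b])
  have "inj T"
    unfolding linear_injective_0[OF linT]
  proof (intro allI impI)
    fix w assume "T w = 0"
    then have "b w = (\<lambda>z. 0)"
      by (intro eqI lin_b) (auto simp: T_def vec_eq_iff module_hom_zero)
    then show "w = 0" using pos[of w] by force
  qed
  then have "surj T" using linT by (simp add: linear_injective_imp_surjective)
  then obtain w where w: "T w = (\<chi> i. \<alpha> (axis i 1))" by (metis surjD)
  have "b w = \<alpha>" by (rule eqI[OF lin_b \<alpha>]) (use w in \<open>simp add: T_def vec_eq_iff\<close>)
  moreover have "v = w" if "\<forall>z. b v z = \<alpha> z" for v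
    using that \<open>b w = \<alpha>\<close> injD[OF \<open>inj T\<close>, of v w] by (simp add: T_def)
  ultimately show ?thesis by auto
qed

text \<open>The Levi-Civita connection is \<open>\<nabla>\<^sub>u V = dV(u) + \<Gamma>(u, V)\<close>. The Christoffel map \<open>\<Gamma>\<close> is
  defined by the Koszul formula for constant vector fields; below it is shown to be the unique
  symmetric (torsion-free) one preserving the metric.\<close>

definition christoffel :: "'n::finite metric_field \<Rightarrow> real^'n \<Rightarrow> real^'n \<Rightarrow> real^'n \<Rightarrow> real^'n"
  where "christoffel g x u v = (THE w. \<forall>z. 2 * g x w z =
     frechet_derivative (\<lambda>y. g y v z) (at x) u + frechet_derivative (\<lambda>y. g y u z) (at x) v
     - frechet_derivative (\<lambda>y. g y u v) (at x) z)"

context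
  fixes U :: "(real^'n::finite) set" and g :: "'n metric_field" and x :: "real^'n"
  assumes g: "riemannian_metric_on U g" and U: "open U" and x: "x \<in> U"
begin

private lemma diff: "(\<lambda>y. g y u v) differentiable (at x)"
proof -
  have "Ck_on (Suc 0) U (\<lambda>y. g y u v)"
    using g unfolding riemannian_metric_on_def smooth_on_def by blast
  then show ?thesis using x by simp
qed

private lemma hd: "((\<lambda>y. g y u v) has_derivative frechet_derivative (\<lambda>y. g y u v) (at x)) (at x)"
  using diff frechet_derivative_works by blast

private lemma bil: "y \<in> U \<Longrightarrow> bilinear (g y)"
  using g unfolding riemannian_metric_on_def by blast

private lemma sym: "y \<in> U \<Longrightarrow> g y u v = g y v u"
  using g unfolding riemannian_metric_on_def by blast

private lemma cong_at:
  assumes "(f has_derivative f') (at x)" "\<And>y. y \<in> U \<Longrightarrow> g y u v = f y"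
  shows "frechet_derivative (\<lambda>y. g y u v) (at x) = f'"
proof -
  have "((\<lambda>y. g y u v) has_derivative f') (at x)"
    by (rule has_derivative_transform_within_open[OF assms(1) U x]) (simp add: assms(2))
  then show ?thesis by (metis frechet_derivative_at)
qed

private lemma D_sym:
  "frechet_derivative (\<lambda>y. g y u v) (at x) = frechet_derivative (\<lambda>y. g y v u) (at x)"
  by (rule cong_at[OF hd sym])

private lemma D_add: "frechet_derivative (\<lambda>y. g y u (v + w)) (at x) z =
  frechet_derivative (\<lambda>y. g y u v) (at x) z + frechet_derivative (\<lambda>y. g y u w) (at x) z"
  by (subst cong_at[OF has_derivative_add[OF hd hd]]) (auto simp: bilinear_radd[OF bil])

private lemma D_scale: "frechet_derivative (\<lambda>y. g y u (c *\<^sub>R v)) (at x) z =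
  c *\<^sub>R frechet_derivative (\<lambda>y. g y u v) (at x) z"
  by (subst cong_at[OF has_derivative_scaleR_right[OF hd]]) (auto simp: bilinear_rmul[OF bil])

lemma christoffel_koszul: "2 * g x (christoffel g x u v) z =
    frechet_derivative (\<lambda>y. g y v z) (at x) u + frechet_derivative (\<lambda>y. g y u z) (at x) v
    - frechet_derivative (\<lambda>y. g y u v) (at x) z"
proof -
  define \<alpha> where "\<alpha> z = frechet_derivative (\<lambda>y. g y v z) (at x) u
    + frechet_derivative (\<lambda>y. g y u z) (at x) v - frechet_derivative (\<lambda>y. g y u v) (at x) z" for z
  have lin: "linear (frechet_derivative (\<lambda>y. g y u v) (at x))"
    using diff linear_frechet_derivative by blast
  have "linear (\<lambda>z. \<alpha> z / 2)"
    by (rule linearI) (simp_all add: \<alpha>_def D_add D_scale linear_add[OF lin] linear_scale[OF lin]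
        field_simps)
  then have "\<exists>!w. \<forall>z. g x w z = \<alpha> z / 2"
    using g x by (intro represent_linear) (auto simp: riemannian_metric_on_def)
  then have "\<exists>!w. \<forall>z. 2 * g x w z = \<alpha> z" by (simp add: field_simps)
  from theI'[OF this] show ?thesis by (simp add: christoffel_def \<alpha>_def)
qed

lemma christoffel_sym: "christoffel g x u v = christoffel g x v u"
  unfolding christoffel_def by (subst D_sym[of u v]) (simp add: add.commute)

lemma christoffel_metric:
  "frechet_derivative (\<lambda>y. g y v w) (at x) u =
     g x (christoffel g x u v) w + g x v (christoffel g x u w)"
  using christoffel_koszul[of u v w] christoffel_koszul[of u w v] D_sym[of v w] D_sym[of u v]
    D_sym[of u w] sym[OF x, of v "christoffel g x u w"] by simp

lemma christoffel_unique:
  assumes sym': "\<And>u v. \<Gamma> u v = \<Gamma> v u"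
    and met: "\<And>u v w. frechet_derivative (\<lambda>y. g y v w) (at x) u = g x (\<Gamma> u v) w + g x v (\<Gamma> u w)"
  shows "\<Gamma> = christoffel g x"
proof (intro ext)
  fix u v
  have "2 * g x (\<Gamma> u v) z = 2 * g x (christoffel g x u v) z" for z
    unfolding christoffel_koszul met
    using sym'[of u v] sym'[of u z] sym'[of v z] sym[OF x] by (smt (verit))
  then have "g x (\<Gamma> u v - christoffel g x u v) z = 0" for z
    using bilinear_lsub[OF bil[OF x]] by simp
  then show "\<Gamma> u v = christoffel g x u v"
    using g x unfolding riemannian_metric_on_def by (metis eq_iff_diff_eq_0 less_irrefl)
qed

end

definition gram :: "(real^'n \<Rightarrow> real^'n \<Rightarrow> real) \<Rightarrow> real^'n^'n::finite"
  where "gram b = (\<chi> i j. b (axis i 1) (axis j 1))"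

definition metric_trace ::
    "(real^'n \<Rightarrow> real^'n \<Rightarrow> real) \<Rightarrow> (real^'n \<Rightarrow> real^'n \<Rightarrow> 'v::real_vector) \<Rightarrow> 'v"
  where "metric_trace b B =
    (\<Sum>i\<in>UNIV. \<Sum>j\<in>(UNIV::'n::finite set). matrix_inv (gram b) $ i $ j *\<^sub>R B (axis i 1) (axis j 1))"

text \<open>\<open>(Dd\<phi>)(u,v)\<close> for the connection on \<open>T\<^sup>*U \<otimes> \<phi>\<^sup>*TV\<close> induced by the Levi-Civita connections.\<close>

definition second_fundamental_form :: "'n::finite metric_field \<Rightarrow> 'm::finite metric_field \<Rightarrow>
    (real^'n \<Rightarrow> real^'m) \<Rightarrow> real^'n \<Rightarrow> real^'n \<Rightarrow> real^'n \<Rightarrow> real^'m"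
  where "second_fundamental_form g h \<phi> x u v =
    frechet_derivative (\<lambda>y. frechet_derivative \<phi> (at y) v) (at x) u
    + christoffel h (\<phi> x) (frechet_derivative \<phi> (at x) u) (frechet_derivative \<phi> (at x) v)
    - frechet_derivative \<phi> (at x) (christoffel g x u v)"

definition tension_field :: "'n::finite metric_field \<Rightarrow> 'm::finite metric_field \<Rightarrow>
    (real^'n \<Rightarrow> real^'m) \<Rightarrow> real^'n \<Rightarrow> real^'m"
  where "tension_field g h \<phi> x = metric_trace (g x) (second_fundamental_form g h \<phi> x)"


subsection \<open>The fundamental 2-vector\<close>

text \<open>2-vectors are skew-symmetric matrices of contravariant components \<open>A\<^sup>i\<^sup>j\<close>. The factor 1/2
  below makes \<open>h(X \<and> Y, Z \<and> W) = h(X,Z) h(Y,W) - h(X,W) h(Y,Z)\<close>.\<close>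

definition wedge :: "real^'n \<Rightarrow> real^'n \<Rightarrow> real^'n^'n::finite"
  where "wedge u v = (\<chi> i j. u $ i * v $ j - u $ j * v $ i)"

definition bivector_inner ::
    "(real^'n \<Rightarrow> real^'n \<Rightarrow> real) \<Rightarrow> real^'n^'n \<Rightarrow> real^'n^'n::finite \<Rightarrow> real"
  where "bivector_inner b A B = (1/2) *
    (\<Sum>i\<in>UNIV. \<Sum>j\<in>UNIV. \<Sum>k\<in>UNIV. \<Sum>l\<in>UNIV. gram b $ i $ k * gram b $ j $ l * A $ i $ j * B $ k $ l)"

definition fundamental_bivector :: "'n::finite metric_field \<Rightarrow> 'n endo_field \<Rightarrow> real^'n \<Rightarrow> real^'n^'n"
  where "fundamental_bivector h J x = (THE A. transpose A = - A \<and>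
    (\<forall>u v. bivector_inner (h x) A (wedge u v) = h x (J x u) v))"

lemma gram_works:
  assumes "bilinear b"
  shows "b u v = u \<bullet> (gram b *v v)"
proof -
  have "b u v = b (\<Sum>i\<in>UNIV. u $ i *\<^sub>R axis i 1) (\<Sum>j\<in>UNIV. v $ j *\<^sub>R axis j 1)"
    using basis_expansion[of u] basis_expansion[of v] by (simp add: scalar_mult_eq_scaleR)
  also have "\<dots> = (\<Sum>i\<in>UNIV. \<Sum>j\<in>UNIV. u $ i * (v $ j * b (axis i 1) (axis j 1)))"
    by (subst bilinear_sum[OF assms]) (simp_all add: sum.cartesian_product bilinear_lmul[OF assms] bilinear_rmul[OF assms] mult_ac)
  finally show ?thesis
    by (simp add: gram_def inner_vec_def matrix_vector_mult_def sum_distrib_left mult.commute)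
qed

lemma bivector_inner_wedge:
  assumes skew: "transpose A = - A"
  shows "bivector_inner b A (wedge u v) = (gram b *v u) \<bullet> (A *v (gram b *v v))"
proof -
  have inner: "(gram b *v u) \<bullet> (A *v (gram b *v v)) =
      (\<Sum>i\<in>UNIV. \<Sum>j\<in>UNIV. \<Sum>k\<in>UNIV. \<Sum>l\<in>UNIV. gram b $ i $ k * gram b $ j $ l * A $ i $ j * (u $ k * v $ l))"
    for u v
    unfolding inner_vec_def matrix_vector_mult_def
    apply (simp only: vec_lambda_beta inner_real_def)
    apply (rule sum.cong[OF refl])
    apply (subst sum_distrib_left)
    apply (rule sum.cong[OF refl])
    apply (subst mult.left_commute)
    apply (subst sum_product)
    apply (simp add: sum_distrib_left mult_ac)
    done
  have "(gram b *v v) \<bullet> (A *v (gram b *v u)) = (transpose A *v (gram b *v v)) \<bullet> (gram b *v u)"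
    using dot_lmul_matrix[of "gram b *v v" A "gram b *v u"] by simp
  also have "\<dots> = - ((gram b *v u) \<bullet> (A *v (gram b *v v)))"
    unfolding skew
    by (simp add: matrix_vector_mult_def inner_vec_def sum_negf mult.commute)
  finally show ?thesis
    using inner[of u v] inner[of v u]
    by (simp add: bivector_inner_def wedge_def right_diff_distrib sum_subtractf mult.commute[of "u $ _"])
qed

lemma fundamental_bivector:
  assumes "almost_hermitian_on U h J" "x \<in> U"
  defines "F \<equiv> fundamental_bivector h J x"
  shows "transpose F = - F" and "bivector_inner (h x) F (wedge u v) = h x (J x u) v"
proof -
  have bil: "bilinear (h x)" and sym: "\<And>u v. h x u v = h x v u"
    and pos: "\<And>v. v \<noteq> 0 \<Longrightarrow> 0 < h x v v" and lin: "linear (J x)"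
    and JJ: "\<And>v. J x (J x v) = - v" and inv: "\<And>u v. h x (J x u) (J x v) = h x u v"
    using assms unfolding almost_hermitian_on_def riemannian_metric_on_def
      almost_complex_structure_on_def by blast+
  define G where "G = gram (h x)"
  have h: "h x u v = u \<bullet> (G *v v)" for u v
    using gram_works[OF bil] by (simp add: G_def)
  have symG: "transpose G = G"
    by (simp add: vec_eq_iff transpose_def G_def gram_def sym)
  have "inj ((*v) G)"
    unfolding linear_injective_0[OF matrix_vector_mul_linear]
    using pos h by (metis inner_zero_right less_irrefl)
  then obtain H where HG: "H ** G = mat 1"
    using matrix_left_invertible_injective[of G] by blast
  then have GH: "G ** H = mat 1" by (simp add: matrix_left_right_inverse)
  have surjG: "G *v (H *v v) = v" "H *v (G *v v) = v" for v
    by (simp_all add: matrix_vector_mul_assoc GH HG)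
  define A where "A = H ** transpose (matrix (J x))"
  have J: "matrix (J x) *v v = J x v" for v using lin by (simp add: matrix_works)
  have neg: "(- M) *v v = - (M *v v)" for M :: "real^'n^'n" and v
    by (simp add: matrix_vector_mult_def vec_eq_iff sum_negf)
  have tr: "(M *v u) \<bullet> v = u \<bullet> (transpose M *v v)" for M :: "real^'n^'n" and u v
    using dot_lmul_matrix[of u "transpose M" v] by simp
  have A: "(G *v u) \<bullet> (A *v (G *v v)) = h x (J x u) v" for u v
    unfolding tr[of G] symG A_def matrix_vector_mul_assoc[symmetric] surjG
    using tr[of "matrix (J x)" u "G *v v"] by (simp add: J h)
  have skewA: "transpose A = - A"
  proof -
    have hJ: "h x (J x u) v = - h x (J x v) u" for u v
      using inv[of u "J x v"] JJ[of v] sym[of u "J x v"] bilinear_rneg[OF bil, of "J x u" v] by simp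
    have "a \<bullet> (transpose A *v c) = a \<bullet> ((- A) *v c)" for a c
    proof -
      have "a \<bullet> (transpose A *v c) = c \<bullet> (A *v a)"
        using tr[of A a c] by (simp add: inner_commute)
      also have "\<dots> = - (a \<bullet> (A *v c))"
        using A[of "H *v c" "H *v a"] A[of "H *v a" "H *v c"]
          hJ[of "H *v a" "H *v c"] inner_commute[of c "A *v a"]
        by (simp add: surjG)
      finally show ?thesis by (simp add: neg)
    qed
    then have "transpose A *v c = (- A) *v c" for c using vector_eq_ldot by blast
    then show ?thesis by (simp add: matrix_eq)
  qed
  have "B = A" if "transpose B = - B" "\<And>u v. bivector_inner (h x) B (wedge u v) = h x (J x u) v" for B
  proof -
    have "(G *v u) \<bullet> (B *v (G *v v)) = (G *v u) \<bullet> (A *v (G *v v))" for u v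
      using that A bivector_inner_wedge[OF that(1)] by (simp add: G_def)
    then have "a \<bullet> (B *v c) = a \<bullet> (A *v c)" for a c
      by (metis surjG(1))
    then have "B *v c = A *v c" for c using vector_eq_ldot by blast
    then show ?thesis by (simp add: matrix_eq)
  qed
  moreover have "bivector_inner (h x) A (wedge u v) = h x (J x u) v" for u v
    using bivector_inner_wedge[OF skewA, of "h x" u v] A[of u v] by (simp only: G_def)
  ultimately have "\<exists>!A. transpose A = - A \<and>
      (\<forall>u v. bivector_inner (h x) A (wedge u v) = h x (J x u) v)"
    using skewA by blast
  from theI'[OF this] show "transpose F = - F" "bivector_inner (h x) F (wedge u v) = h x (J x u) v"
    unfolding F_def fundamental_bivector_def by blast+
qed

text \<open>\<open>(\<nabla>\<^sub>u A)\<^sup>i\<^sup>j = dA\<^sup>i\<^sup>j(u) + \<Gamma>(u)\<^sup>i\<^sub>k A\<^sup>k\<^sup>j + \<Gamma>(u)\<^sup>j\<^sub>k A\<^sup>i\<^sup>k\<close>\<close>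

definition nabla_bivector ::
    "'n::finite metric_field \<Rightarrow> (real^'n \<Rightarrow> real^'n^'n) \<Rightarrow> real^'n \<Rightarrow> real^'n \<Rightarrow> real^'n^'n"
  where "nabla_bivector g A x u =
    frechet_derivative A (at x) u + matrix (christoffel g x u) ** A x
    + A x ** transpose (matrix (christoffel g x u))"

text \<open>\<open>\<nabla>F\<close> as an element of \<open>T \<otimes> \<And>\<^sup>2T\<close>, complexified: the first index is the derivative slot,
  raised by \<open>h\<close>.\<close>

definition nablaF ::
    "'n::finite metric_field \<Rightarrow> 'n endo_field \<Rightarrow> real^'n \<Rightarrow> complex^'n^'n^'n"
  where "nablaF h J x = (\<chi> k i j. complex_of_real (\<Sum>l\<in>UNIV.
     matrix_inv (gram (h x)) $ k $ l *
     nabla_bivector h (fundamental_bivector h J) x (axis l 1) $ i $ j))"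

text \<open>The projections \<open>(1 - \<i>J)/2\<close> and \<open>(1 + \<i>J)/2\<close> of the complexified tangent space onto the
  eigenspaces \<open>T\<^sup>1\<^sup>,\<^sup>0\<close> and \<open>T\<^sup>0\<^sup>,\<^sup>1\<close> of the complexification of \<open>J\<close>.\<close>

definition proj10 :: "(real^'n \<Rightarrow> real^'n) \<Rightarrow> complex^'n^'n::finite"
  where "proj10 J = (\<chi> i j. (of_bool (i = j) - \<i> * complex_of_real (matrix J $ i $ j)) / 2)"

definition proj01 :: "(real^'n \<Rightarrow> real^'n) \<Rightarrow> complex^'n^'n::finite"
  where "proj01 J = (\<chi> i j. (of_bool (i = j) + \<i> * complex_of_real (matrix J $ i $ j)) / 2)"

definition tensor_map :: "complex^'n^'n \<Rightarrow> complex^'n^'n \<Rightarrow> complex^'n^'n \<Rightarrow>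
    complex^'n^'n^'n \<Rightarrow> complex^'n^'n^'n::finite"
  where "tensor_map P Q R t = (\<chi> a b c.
    \<Sum>k\<in>UNIV. \<Sum>i\<in>UNIV. \<Sum>j\<in>UNIV. P $ a $ k * Q $ b $ i * R $ c $ j * t $ k $ i $ j)"

definition D2F :: "'n::finite metric_field \<Rightarrow> 'n endo_field \<Rightarrow> real^'n \<Rightarrow> complex^'n^'n^'n"
  where "D2F h J x =
    tensor_map (proj10 (J x)) (proj01 (J x)) (proj01 (J x)) (nablaF h J x) +
    tensor_map (proj01 (J x)) (proj10 (J x)) (proj10 (J x)) (nablaF h J x)"

definition tensor_trace ::
    "(real^'n \<Rightarrow> real^'n \<Rightarrow> real) \<Rightarrow> complex^'n^'n^'n \<Rightarrow> complex^'n::finite"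
  where "tensor_trace b t =
    (\<chi> j. \<Sum>k\<in>UNIV. \<Sum>i\<in>UNIV. complex_of_real (gram b $ k $ i) * t $ k $ i $ j)"

definition symplectic12_on :: "(real^'n) set \<Rightarrow> 'n::finite metric_field \<Rightarrow> 'n endo_field \<Rightarrow> bool"
  where "symplectic12_on U h J \<longleftrightarrow> (\<forall>x\<in>U. D2F h J x = 0)"

definition cosymplectic_on :: "(real^'n) set \<Rightarrow> 'n::finite metric_field \<Rightarrow> 'n endo_field \<Rightarrow> bool"
  where "cosymplectic_on U h J \<longleftrightarrow> (\<forall>x\<in>U. tensor_trace (h x) (D2F h J x) = 0)"


section \<open>Almost Hermitian orbifolds\<close>

definition riemannian_orbifold :: "'a topology \<Rightarrow> ('a, 'n::finite) orbifold_chart set \<Rightarrow>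
    (('a, 'n) orbifold_chart \<Rightarrow> 'n metric_field) \<Rightarrow> bool"
  where "riemannian_orbifold X \<A> g \<longleftrightarrow> orbifold X \<A> \<and>
    (\<forall>C\<in>\<A>. riemannian_metric_on (chart_dom C) (g C) \<and>
      (\<forall>\<gamma>\<in>chart_group C. \<forall>x\<in>chart_dom C. \<forall>u v.
         g C (\<gamma> x) (frechet_derivative \<gamma> (at x) u) (frechet_derivative \<gamma> (at x) v) = g C x u v)) \<and>
    (\<forall>C\<in>\<A>. \<forall>D\<in>\<A>. \<forall>\<iota>. chart_embedding C D \<iota> \<longrightarrow> (\<forall>x\<in>chart_dom C. \<forall>u v.
         g D (\<iota> x) (frechet_derivative \<iota> (at x) u) (frechet_derivative \<iota> (at x) v) = g C x u v))"

definition almost_hermitian_orbifold :: "'a topology \<Rightarrow> ('a, 'n::finite) orbifold_chart set \<Rightarrow>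
    (('a, 'n) orbifold_chart \<Rightarrow> 'n metric_field) \<Rightarrow> (('a, 'n) orbifold_chart \<Rightarrow> 'n endo_field) \<Rightarrow> bool"
  where "almost_hermitian_orbifold X \<A> h J \<longleftrightarrow> riemannian_orbifold X \<A> h \<and>
    (\<forall>C\<in>\<A>. almost_hermitian_on (chart_dom C) (h C) (J C) \<and>
      (\<forall>\<gamma>\<in>chart_group C. \<forall>x\<in>chart_dom C. \<forall>u.
         frechet_derivative \<gamma> (at x) (J C x u) = J C (\<gamma> x) (frechet_derivative \<gamma> (at x) u))) \<and>
    (\<forall>C\<in>\<A>. \<forall>D\<in>\<A>. \<forall>\<iota>. chart_embedding C D \<iota> \<longrightarrow> (\<forall>x\<in>chart_dom C. \<forall>u.
         frechet_derivative \<iota> (at x) (J C x u) = J D (\<iota> x) (frechet_derivative \<iota> (at x) u)))"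

definition cosymplectic_orbifold :: "'a topology \<Rightarrow> ('a, 'n::finite) orbifold_chart set \<Rightarrow>
    (('a, 'n) orbifold_chart \<Rightarrow> 'n metric_field) \<Rightarrow> (('a, 'n) orbifold_chart \<Rightarrow> 'n endo_field) \<Rightarrow> bool"
  where "cosymplectic_orbifold X \<A> h J \<longleftrightarrow> almost_hermitian_orbifold X \<A> h J \<and>
    (\<forall>C\<in>\<A>. cosymplectic_on (chart_dom C) (h C) (J C))"

definition symplectic12_orbifold :: "'a topology \<Rightarrow> ('a, 'n::finite) orbifold_chart set \<Rightarrow>
    (('a, 'n) orbifold_chart \<Rightarrow> 'n metric_field) \<Rightarrow> (('a, 'n) orbifold_chart \<Rightarrow> 'n endo_field) \<Rightarrow> bool"
  where "symplectic12_orbifold X \<A> h J \<longleftrightarrow> almost_hermitian_orbifold X \<A> h J \<and>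
    (\<forall>C\<in>\<A>. symplectic12_on (chart_dom C) (h C) (J C))"


section \<open>Complete orbifold maps\<close>

record ('a, 'n, 'b, 'm) local_lift =
  lift_source :: "('a, 'n) orbifold_chart"
  lift_target :: "('b, 'm) orbifold_chart"
  lift_map :: "real^'n \<Rightarrow> real^'m"
  lift_hom :: "(real^'n \<Rightarrow> real^'n) \<Rightarrow> (real^'m \<Rightarrow> real^'m)"

definition local_lift :: "('a, 'n::finite) orbifold_chart set \<Rightarrow> ('b, 'm::finite) orbifold_chart set \<Rightarrow>
    ('a \<Rightarrow> 'b) \<Rightarrow> ('a, 'n, 'b, 'm) local_lift \<Rightarrow> bool"
  where "local_lift \<A> \<B> \<phi> L \<longleftrightarrow>
    lift_source L \<in> \<A> \<and> lift_target L \<in> \<B> \<and>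
    lift_map L ` chart_dom (lift_source L) \<subseteq> chart_dom (lift_target L) \<and>
    smooth_on (chart_dom (lift_source L)) (lift_map L) \<and>
    (\<forall>x\<in>chart_dom (lift_source L).
       chart_map (lift_target L) (lift_map L x) = \<phi> (chart_map (lift_source L) x)) \<and>
    lift_hom L \<in> hom (local_group (lift_source L)) (local_group (lift_target L)) \<and>
    (\<forall>\<gamma>\<in>chart_group (lift_source L). \<forall>x\<in>chart_dom (lift_source L).
       lift_map L (\<gamma> x) = lift_hom L \<gamma> (lift_map L x))"

text \<open>\<open>\<kappa>\<close> is the homomorphism of local groups for which \<open>\<iota>\<close> is equivariant; it is determined
  by \<open>\<iota>\<close> when the domain of \<open>C\<close> is nonempty.\<close>

definition equivariant_chart_embedding :: "('a, 'n::finite) orbifold_chart \<Rightarrow> ('a, 'n) orbifold_chart \<Rightarrow>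
    (real^'n \<Rightarrow> real^'n) \<Rightarrow> ((real^'n \<Rightarrow> real^'n) \<Rightarrow> (real^'n \<Rightarrow> real^'n)) \<Rightarrow> bool"
  where "equivariant_chart_embedding C D \<iota> \<kappa> \<longleftrightarrow>
    chart_embedding C D \<iota> \<and> \<kappa> \<in> hom (local_group C) (local_group D) \<and>
    (\<forall>\<gamma>\<in>chart_group C. \<forall>x\<in>chart_dom C. \<iota> (\<gamma> x) = \<kappa> \<gamma> (\<iota> x))"

text \<open>\<open>K\<close> is the lift induced by \<open>L\<close> on smaller charts of source and target.\<close>

definition lift_refines ::
    "('a, 'n::finite, 'b, 'm::finite) local_lift \<Rightarrow> ('a, 'n, 'b, 'm) local_lift \<Rightarrow> bool"
  where "lift_refines K L \<longleftrightarrow>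
    (\<exists>\<iota> \<kappa> \<mu> \<nu>. equivariant_chart_embedding (lift_source K) (lift_source L) \<iota> \<kappa> \<and>
       equivariant_chart_embedding (lift_target K) (lift_target L) \<mu> \<nu> \<and>
       (\<forall>x\<in>chart_dom (lift_source K). lift_map L (\<iota> x) = \<mu> (lift_map K x)) \<and>
       (\<forall>\<gamma>\<in>chart_group (lift_source K). lift_hom L (\<kappa> \<gamma>) = \<nu> (lift_hom K \<gamma>)))"

text \<open>Compatibility of lifts with changes of charts is expressed as for charts: near each common
  point, two lifts are induced on the same smaller lift.\<close>

definition compatible_lifts :: "('a, 'n::finite) orbifold_chart set \<Rightarrow> ('b, 'm::finite) orbifold_chart set \<Rightarrow>
    ('a \<Rightarrow> 'b) \<Rightarrow> ('a, 'n, 'b, 'm) local_lift \<Rightarrow> ('a, 'n, 'b, 'm) local_lift \<Rightarrow> bool"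
  where "compatible_lifts \<A> \<B> \<phi> L M \<longleftrightarrow>
    (\<forall>p \<in> chart_image (lift_source L) \<inter> chart_image (lift_source M).
       \<exists>K. local_lift \<A> \<B> \<phi> K \<and> p \<in> chart_image (lift_source K) \<and>
           lift_refines K L \<and> lift_refines K M)"

definition complete_orbifold_map :: "'a topology \<Rightarrow> ('a, 'n::finite) orbifold_chart set \<Rightarrow>
    'b topology \<Rightarrow> ('b, 'm::finite) orbifold_chart set \<Rightarrow>
    ('a \<Rightarrow> 'b) \<Rightarrow> ('a \<Rightarrow> ('a, 'n, 'b, 'm) local_lift) \<Rightarrow> bool"
  where "complete_orbifold_map X \<A> Y \<B> \<phi> L \<longleftrightarrow>
    continuous_map X Y \<phi> \<and>
    (\<forall>p\<in>topspace X. local_lift \<A> \<B> \<phi> (L p) \<and> p \<in> chart_image (lift_source (L p))) \<and>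
    (\<forall>p\<in>topspace X. \<forall>q\<in>topspace X. compatible_lifts \<A> \<B> \<phi> (L p) (L q))"

definition holomorphic_orbifold_map :: "'a topology \<Rightarrow>
    (('a, 'n::finite) orbifold_chart \<Rightarrow> 'n endo_field) \<Rightarrow>
    (('b, 'm::finite) orbifold_chart \<Rightarrow> 'm endo_field) \<Rightarrow>
    ('a \<Rightarrow> ('a, 'n, 'b, 'm) local_lift) \<Rightarrow> bool"
  where "holomorphic_orbifold_map X JX JY L \<longleftrightarrow>
    (\<forall>p\<in>topspace X. let C = lift_source (L p); D = lift_target (L p); f = lift_map (L p) in
      \<forall>x\<in>chart_dom C. \<forall>u.
        frechet_derivative f (at x) (JX C x u) = JY D (f x) (frechet_derivative f (at x) u))"

definition harmonic_orbifold_map :: "'a topology \<Rightarrow>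
    (('a, 'n::finite) orbifold_chart \<Rightarrow> 'n metric_field) \<Rightarrow>
    (('b, 'm::finite) orbifold_chart \<Rightarrow> 'm metric_field) \<Rightarrow>
    ('a \<Rightarrow> ('a, 'n, 'b, 'm) local_lift) \<Rightarrow> bool"
  where "harmonic_orbifold_map X g h L \<longleftrightarrow>
    (\<forall>p\<in>topspace X. let C = lift_source (L p); D = lift_target (L p) in
      \<forall>x\<in>chart_dom C. tension_field (g C) (h D) (lift_map (L p)) x = 0)"

end

theory Submission
  imports Defs
begin

text \<open>The claim is local. For a holomorphic lift \<open>f\<close> with second fundamental form \<open>B = Ddf\<close>,
  differentiating \<open>df \<circ> J = I \<circ> df\<close> covariantly gives
  \<open>B(u, Jv) = I B(u, v) + (\<nabla>\<^bsub>df u\<^esub> I)(df v) - df((\<nabla>\<^sub>u J)v)\<close>.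
  Take the trace over the source metric. On the left it vanishes, because \<open>B\<close> is symmetric and \<open>J\<close>
  is skew. Since \<open>\<nabla>J\<close> anticommutes with \<open>J\<close>, \<open>D\<^sub>2F = 0\<close> means
  \<open>(\<nabla>\<^sub>u J)v = - (\<nabla>\<^bsub>Ju\<^esub> J)(Jv)\<close>, so the \<open>I\<close>-term changes sign under
  \<open>(u, v) \<mapsto> (Ju, Jv)\<close>, a substitution that preserves traces; hence its trace is zero. Likewise
  \<open>tr(D\<^sub>2F) = 0\<close> means that the trace of \<open>(\<nabla>\<^sub>u J)v\<close> is zero. What remains is
  \<open>I \<tau>(f) = 0\<close>.\<close>

section \<open>Symmetry of the second derivative\<close>

text \<open>Two applications of the mean value theorem: along \<open>u\<close> to the increment of
  \<open>f\<close> across the parallelogram, then along \<open>v\<close> to the partial derivative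
  \<open>f' _ u\<close>. The left side is symmetric in \<open>u\<close> and \<open>v\<close>, while
  the right side sees only one order of differentiation.\<close>

lemma second_difference_mvt:
  fixes f :: "'a::real_normed_vector \<Rightarrow> real"
  assumes t: "0 < t"
    and f: "\<And>a b. \<lbrakk>0 \<le> a; a \<le> t; 0 \<le> b; b \<le> t\<rbrakk> \<Longrightarrow>
      (f has_derivative f' (x + a *\<^sub>R u + b *\<^sub>R v)) (at (x + a *\<^sub>R u + b *\<^sub>R v))"
    and f': "\<And>a b. \<lbrakk>0 \<le> a; a \<le> t; 0 \<le> b; b \<le> t\<rbrakk> \<Longrightarrow>
      ((\<lambda>y. f' y u) has_derivative f'' (x + a *\<^sub>R u + b *\<^sub>R v)) (at (x + a *\<^sub>R u + b *\<^sub>R v))"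
  shows "\<exists>a b. 0 < a \<and> a < t \<and> 0 < b \<and> b < t \<and>
    f (x + t *\<^sub>R u + t *\<^sub>R v) - f (x + t *\<^sub>R u) - f (x + t *\<^sub>R v) + f x =
    t * (t * f'' (x + a *\<^sub>R u + b *\<^sub>R v) v)"
proof -
  have "((\<lambda>a. f (x + a *\<^sub>R u + b *\<^sub>R v)) has_derivative
      (\<lambda>s. f' (x + a *\<^sub>R u + b *\<^sub>R v) (s *\<^sub>R u))) (at a within {0..t})"
    if "0 \<le> a" "a \<le> t" "0 \<le> b" "b \<le> t" for a b
  proof -
    have "((\<lambda>a. x + a *\<^sub>R u + b *\<^sub>R v) has_derivative (\<lambda>s. s *\<^sub>R u)) (at a within {0..t})"
      by (auto intro!: derivative_eq_intros)
    from has_derivative_compose[OF this f[OF that]] show ?thesis .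
  qed
  \<comment> \<open>The parameter along \<open>u\<close> varies; the function is the difference of
    \<open>f\<close> between the opposite edges \<open>b = t\<close> and
    \<open>b = 0\<close>.\<close>
  from has_derivative_diff[OF this[of _ t] this[of _ 0]] t
  have "\<exists>a\<in>{0<..<t}. (f (x + t *\<^sub>R u + t *\<^sub>R v) - f (x + t *\<^sub>R u)) - (f (x + t *\<^sub>R v) - f x)
      = f' (x + a *\<^sub>R u + t *\<^sub>R v) ((t - 0) *\<^sub>R u) - f' (x + a *\<^sub>R u) ((t - 0) *\<^sub>R u)"
    using mvt_simple[of 0 t "\<lambda>a. f (x + a *\<^sub>R u + t *\<^sub>R v) - f (x + a *\<^sub>R u)"
      "\<lambda>a s. f' (x + a *\<^sub>R u + t *\<^sub>R v) (s *\<^sub>R u) - f' (x + a *\<^sub>R u) (s *\<^sub>R u)"] by simp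
  then obtain a where a: "0 < a" "a < t" and eq1:
    "f (x + t *\<^sub>R u + t *\<^sub>R v) - f (x + t *\<^sub>R u) - f (x + t *\<^sub>R v) + f x
      = f' (x + a *\<^sub>R u + t *\<^sub>R v) (t *\<^sub>R u) - f' (x + a *\<^sub>R u) (t *\<^sub>R u)"
    by auto
  have scale: "f' (x + a *\<^sub>R u + b *\<^sub>R v) (t *\<^sub>R u) = t * f' (x + a *\<^sub>R u + b *\<^sub>R v) u"
    if "0 \<le> b" "b \<le> t" for b
    using has_derivative_linear[OF f[of a b]] a that by (simp add: linear_cmul)
  have "((\<lambda>b. f' (x + a *\<^sub>R u + b *\<^sub>R v) u) has_derivative
      (\<lambda>s. f'' (x + a *\<^sub>R u + b *\<^sub>R v) (s *\<^sub>R v))) (at b within {0..t})"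
    if "0 \<le> b" "b \<le> t" for b
  proof -
    have "((\<lambda>b. x + a *\<^sub>R u + b *\<^sub>R v) has_derivative (\<lambda>s. s *\<^sub>R v)) (at b within {0..t})"
      by (auto intro!: derivative_eq_intros)
    from has_derivative_compose[OF this, where g = "\<lambda>y. f' y u"] f'[of a b] a that show ?thesis by simp
  qed
  from mvt_simple[OF t this]
  obtain b where b: "0 < b" "b < t" and
    "f' (x + a *\<^sub>R u + t *\<^sub>R v) u - f' (x + a *\<^sub>R u) u = f'' (x + a *\<^sub>R u + b *\<^sub>R v) (t *\<^sub>R v)"
    by auto
  moreover have "f'' (x + a *\<^sub>R u + b *\<^sub>R v) (t *\<^sub>R v) = t * f'' (x + a *\<^sub>R u + b *\<^sub>R v) v"
    using has_derivative_linear[OF f'[of a b]] a b by (simp add: linear_cmul)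
  ultimately show ?thesis
    using a b eq1 scale[of t] scale[of 0] t
    by (intro exI[of _ a] exI[of _ b]) (simp flip: right_diff_distrib)
qed

text \<open>One second difference equals \<open>t * t\<close> times either mixed derivative, each at
  some point of a small parallelogram at \<open>x\<close>. By continuity both values are close to
  those at \<open>x\<close>, so the two mixed derivatives cannot differ there.\<close>

lemma second_derivative_symmetric_real:
  fixes f :: "'a::real_normed_vector \<Rightarrow> real"
  assumes U: "open U" "x \<in> U"
    and f: "\<And>y. y \<in> U \<Longrightarrow> (f has_derivative f' y) (at y)"
    and f'': "\<And>y w. y \<in> U \<Longrightarrow> ((\<lambda>y. f' y w) has_derivative f'' w y) (at y)"
    and cont: "\<And>w z. continuous_on U (\<lambda>y. f'' w y z)"
  shows "f'' u x v = f'' v x u"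
proof (rule ccontr)
  assume neq: "f'' u x v \<noteq> f'' v x u"
  \<comment> \<open>Half the gap: values within \<epsilon> of the two mixed derivatives at
    \<open>x\<close> cannot coincide.\<close>
  define \<epsilon> where "\<epsilon> = \<bar>f'' u x v - f'' v x u\<bar> / 2"
  have "\<epsilon> > 0" using neq by (simp add: \<epsilon>_def)
  have "\<forall>\<^sub>F y in nhds x. y \<in> U \<and> dist (f'' u y v) (f'' u x v) < \<epsilon> \<and> dist (f'' v y u) (f'' v x u) < \<epsilon>"
  proof (intro eventually_conj)
    show "\<forall>\<^sub>F y in nhds x. y \<in> U" using U by (rule eventually_nhds_in_open)
    have "\<forall>\<^sub>F y in nhds x. dist (f'' w y z) (f'' w x z) < \<epsilon>" for w z
    proof -
      have "isCont (\<lambda>y. f'' w y z) x"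
        using cont U continuous_on_eq_continuous_at by blast
      then have "((\<lambda>y. f'' w y z) \<longlongrightarrow> f'' w x z) (nhds x)"
        unfolding isCont_def tendsto_at_iff_tendsto_nhds[of "\<lambda>y. f'' w y z"] .
      then show ?thesis using \<open>\<epsilon> > 0\<close> by (rule tendstoD)
    qed
    then show "\<forall>\<^sub>F y in nhds x. dist (f'' u y v) (f'' u x v) < \<epsilon>"
      "\<forall>\<^sub>F y in nhds x. dist (f'' v y u) (f'' v x u) < \<epsilon>" by blast+
  qed
  then obtain d where d: "d > 0" and near: "\<And>y. dist y x < d \<Longrightarrow>
      y \<in> U \<and> dist (f'' u y v) (f'' u x v) < \<epsilon> \<and> dist (f'' v y u) (f'' v x u) < \<epsilon>"
    unfolding eventually_nhds_metric by blast
  \<comment> \<open>Chosen so that the whole parallelogram with sides \<open>t u\<close> and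
    \<open>t v\<close> lies within distance \<open>d\<close> of \<open>x\<close>; the summand 1
    keeps the denominator positive when \<open>u\<close> and \<open>v\<close> vanish.\<close>
  define t where "t = d / (2 * (norm u + norm v + 1))"
  have pos: "norm u + norm v + 1 > 0" by (smt (verit) norm_ge_zero)
  then have t: "0 < t" using d by (simp add: t_def)
  have close: "dist (x + a *\<^sub>R u + b *\<^sub>R v) x < d" if "0 \<le> a" "a \<le> t" "0 \<le> b" "b \<le> t" for a b
  proof -
    have "dist (x + a *\<^sub>R u + b *\<^sub>R v) x \<le> a * norm u + b * norm v"
      using norm_triangle_ineq[of "a *\<^sub>R u" "b *\<^sub>R v"] that by (simp add: dist_norm)
    also have "\<dots> \<le> t * norm u + t * norm v"
      using that by (intro add_mono mult_right_mono) auto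
    also have "\<dots> < 2 * (t * (norm u + norm v + 1))" 
      using t by (simp add: distrib_left add_nonneg_pos)
    also have "\<dots> = d" using pos by (simp add: t_def field_simps)
    finally show ?thesis .
  qed
  obtain a b where ab: "0 < a" "a < t" "0 < b" "b < t" and 1:
    "f (x + t *\<^sub>R u + t *\<^sub>R v) - f (x + t *\<^sub>R u) - f (x + t *\<^sub>R v) + f x =
    t * (t * f'' u (x + a *\<^sub>R u + b *\<^sub>R v) v)"
    using second_difference_mvt[where f=f and f'=f' and f''="f'' u" and x=x and u=u and v=v, OF t]
      f f'' near close by blast
  \<comment> \<open>With \<open>u\<close> and \<open>v\<close> exchanged, the points are the same
    ones written in another order, so \<open>close\<close> covers them as well.\<close>
  have swap: "x + a *\<^sub>R v + b *\<^sub>R u = x + b *\<^sub>R u + a *\<^sub>R v" for a b by simp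
  obtain a' b' where ab': "0 < a'" "a' < t" "0 < b'" "b' < t" and 2:
    "f (x + t *\<^sub>R v + t *\<^sub>R u) - f (x + t *\<^sub>R v) - f (x + t *\<^sub>R u) + f x =
    t * (t * f'' v (x + a' *\<^sub>R v + b' *\<^sub>R u) u)"
    using second_difference_mvt[where f=f and f'=f' and f''="f'' v" and x=x and u=v and v=u, OF t]
      f f'' near close unfolding swap by blast
  \<comment> \<open>Both sides come from the same second difference; dividing by \<open>t\<close>
    twice makes the two intermediate values equal.\<close>
  have "f'' u (x + a *\<^sub>R u + b *\<^sub>R v) v = f'' v (x + b' *\<^sub>R u + a' *\<^sub>R v) u"
  proof -
    have "t * (t * f'' u (x + a *\<^sub>R u + b *\<^sub>R v) v) = t * (t * f'' v (x + b' *\<^sub>R u + a' *\<^sub>R v) u)"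
      using 1 2 unfolding swap by linarith
    then show ?thesis using t by simp
  qed
  moreover have "dist (f'' u (x + a *\<^sub>R u + b *\<^sub>R v) v) (f'' u x v) < \<epsilon>"
    using near close ab by simp
  moreover have "dist (f'' v (x + b' *\<^sub>R u + a' *\<^sub>R v) u) (f'' v x u) < \<epsilon>"
    using near close ab' by simp
  ultimately show False
    by (simp add: \<epsilon>_def dist_real_def abs_if field_simps split: if_splits)
qed

text \<open>Each component along a basis vector falls under the real-valued case.\<close>

lemma second_derivative_symmetric:
  fixes f :: "'a::real_normed_vector \<Rightarrow> 'b::euclidean_space"
  assumes U: "open U" "x \<in> U" and f: "Ck_on (Suc (Suc 0)) U f"
  shows "frechet_derivative (\<lambda>y. frechet_derivative f (at y) u) (at x) v =
    frechet_derivative (\<lambda>y. frechet_derivative f (at y) v) (at x) u"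
proof (rule euclidean_eqI)
  fix i :: 'b assume "i \<in> Basis"
  show "frechet_derivative (\<lambda>y. frechet_derivative f (at y) u) (at x) v \<bullet> i =
    frechet_derivative (\<lambda>y. frechet_derivative f (at y) v) (at x) u \<bullet> i"
  proof (rule second_derivative_symmetric_real[OF U,
        where f = "\<lambda>y. f y \<bullet> i" and f' = "\<lambda>y w. frechet_derivative f (at y) w \<bullet> i"
          and f'' = "\<lambda>w y z. frechet_derivative (\<lambda>y. frechet_derivative f (at y) w) (at y) z \<bullet> i"])
    show "((\<lambda>y. f y \<bullet> i) has_derivative (\<lambda>w. frechet_derivative f (at y) w \<bullet> i)) (at y)"
      if "y \<in> U" for y
      using f that by (intro has_derivative_inner_left) (simp add: frechet_derivative_works)
    show "((\<lambda>y. frechet_derivative f (at y) w \<bullet> i) has_derivative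
        (\<lambda>z. frechet_derivative (\<lambda>y. frechet_derivative f (at y) w) (at y) z \<bullet> i)) (at y)"
      if "y \<in> U" for y w
      using f that by (intro has_derivative_inner_left) (simp add: frechet_derivative_works)
    show "continuous_on U (\<lambda>y. frechet_derivative (\<lambda>y. frechet_derivative f (at y) w) (at y) z \<bullet> i)"
      for w z
      using f by (intro continuous_intros) auto
  qed
qed

section \<open>Matrix calculus\<close>

lemma has_derivative_vec_nthI:
  fixes f :: "'a::real_normed_vector \<Rightarrow> 'b::euclidean_space^'n"
  assumes "\<And>i. ((\<lambda>y. f y $ i) has_derivative (\<lambda>u. f' u $ i)) (at x within S)"
  shows "(f has_derivative f') (at x within S)"
  unfolding has_derivative_componentwise_within[of f]
  by (auto simp: Basis_vec_def inner_axis intro!: has_derivative_inner_left assms)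

lemma differentiable_vec_nthI:
  fixes f :: "'a::real_normed_vector \<Rightarrow> 'b::euclidean_space^'n"
  assumes "\<And>i. (\<lambda>y. f y $ i) differentiable (at x within S)"
  shows "f differentiable (at x within S)"
  unfolding differentiable_componentwise_within[of f]
  by (auto simp: Basis_vec_def inner_axis intro!: differentiable_inner assms)

lemma bounded_bilinear_matrix_mult:
  "bounded_bilinear ((**) :: real^'n^'m \<Rightarrow> real^'p^'n \<Rightarrow> real^'p^'m)"
  unfolding bilinear_conv_bounded_bilinear[symmetric] bilinear_def
  by (auto intro!: linearI simp: vec_eq_iff matrix_matrix_mult_def
      distrib_left distrib_right sum.distrib sum_distrib_left mult_ac)

lemma bounded_bilinear_matrix_vector_mult:
  "bounded_bilinear ((*v) :: real^'n^'m \<Rightarrow> real^'n \<Rightarrow> real^'m)"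
  unfolding bilinear_conv_bounded_bilinear[symmetric] bilinear_def
  by (auto intro!: linearI simp: matrix_vector_right_distrib matrix_vector_mult_add_rdistrib
      matrix_vector_mult_scaleR scaleR_matrix_vector_assoc)

lemma bounded_linear_transpose: "bounded_linear (transpose :: real^'n^'m \<Rightarrow> real^'m^'n)"
  unfolding linear_conv_bounded_linear[symmetric]
  by (rule linearI) (simp_all add: vec_eq_iff transpose_def)

lemmas matrix_bilinear_simps =
  bounded_bilinear.add_left[OF bounded_bilinear_matrix_mult]
  bounded_bilinear.add_right[OF bounded_bilinear_matrix_mult]
  bounded_bilinear.diff_left[OF bounded_bilinear_matrix_mult]
  bounded_bilinear.diff_right[OF bounded_bilinear_matrix_mult]
  bounded_bilinear.minus_left[OF bounded_bilinear_matrix_mult]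
  bounded_bilinear.minus_right[OF bounded_bilinear_matrix_mult]
  bounded_bilinear.scaleR_left[OF bounded_bilinear_matrix_mult]
  bounded_bilinear.scaleR_right[OF bounded_bilinear_matrix_mult]
  bounded_bilinear.add_left[OF bounded_bilinear_matrix_vector_mult]
  bounded_bilinear.add_right[OF bounded_bilinear_matrix_vector_mult]
  bounded_bilinear.diff_left[OF bounded_bilinear_matrix_vector_mult]
  bounded_bilinear.diff_right[OF bounded_bilinear_matrix_vector_mult]
  bounded_bilinear.minus_left[OF bounded_bilinear_matrix_vector_mult]
  bounded_bilinear.minus_right[OF bounded_bilinear_matrix_vector_mult]
  bounded_bilinear.scaleR_left[OF bounded_bilinear_matrix_vector_mult]
  bounded_bilinear.scaleR_right[OF bounded_bilinear_matrix_vector_mult]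
  linear_add[OF bounded_linear.linear[OF bounded_linear_transpose]]
  linear_diff[OF bounded_linear.linear[OF bounded_linear_transpose]]
  linear_neg[OF bounded_linear.linear[OF bounded_linear_transpose]]
  linear_cmul[OF bounded_linear.linear[OF bounded_linear_transpose]]

lemma has_derivative_matrix:
  fixes A :: "'a::real_normed_vector \<Rightarrow> real^'n \<Rightarrow> real^'m"
  assumes "\<And>j. ((\<lambda>y. A y (axis j 1)) has_derivative A' j) (at x within S)"
  shows "((\<lambda>y. matrix (A y)) has_derivative (\<lambda>u. \<chi> i j. A' j u $ i)) (at x within S)"
  using assms
  by (intro has_derivative_vec_nthI)
    (auto simp: matrix_def intro: bounded_linear.has_derivative[OF bounded_linear_vec_nth])

section \<open>Differentiating the inverse of a matrix field\<close>

lemma differentiable_det: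
  fixes A :: "'a::real_normed_vector \<Rightarrow> real^'n^'n"
  assumes "\<And>i j. (\<lambda>y. A y $ i $ j) differentiable (at x within S)"
  shows "(\<lambda>y. det (A y)) differentiable (at x within S)"
proof -
  \<comment> \<open>The determinant is a polynomial in the entries by the Leibniz formula.
    Derivatives of all entries are fixed first, so that the sum and product rules can build the
    derivative of that polynomial.\<close>
  from assms have "\<exists>A'. \<forall>i j. ((\<lambda>y. A y $ i $ j) has_derivative A' i j) (at x within S)"
    unfolding differentiable_def by metis
  then obtain A' where A': "\<And>i j. ((\<lambda>y. A y $ i $ j) has_derivative A' i j) (at x within S)" by blast
  show ?thesis
    unfolding det_def differentiable_def
    by (rule exI) (rule has_derivative_sum has_derivative_mult_right has_derivative_prod A')+
qed

lemma matrix_inv_right_left: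
  fixes A :: "real^'n^'n"
  assumes "invertible A"
  shows matrix_inv_right: "A ** matrix_inv A = mat 1"
    and matrix_inv_left: "matrix_inv A ** A = mat 1"
  using assms someI_ex[of "\<lambda>A'. A ** A' = mat 1 \<and> A' ** A = mat 1"]
  by (simp_all add: invertible_def matrix_inv_def)

text \<open>The column \<open>l\<close> of the inverse solves \<open>A *v w = axis l 1\<close>, so
  Cramer's rule gives its entries. As quotients of determinants they are visibly differentiable in
  the entries of \<open>A\<close>.\<close>

lemma matrix_inv_cramer:
  fixes A :: "real^'n^'n"
  assumes "det A \<noteq> 0"
  shows "matrix_inv A $ k $ l = det (\<chi> i j. if j = k then axis l 1 $ i else A $ i $ j) / det A"
proof -
  have "invertible A" using assms by (simp add: invertible_det_nz)
  then have "A *v (matrix_inv A *v axis l 1) = axis l 1"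
    by (simp add: matrix_vector_mul_assoc matrix_inv_right)
  then have "matrix_inv A *v axis l 1 =
      (\<chi> k. det (\<chi> i j. if j = k then axis l 1 $ i else A $ i $ j) / det A)"
    using cramer[OF assms] by blast
  then have "(matrix_inv A *v axis l 1) $ k = 
      det (\<chi> i j. if j = k then axis l 1 $ i else A $ i $ j) / det A" by simp
  then show ?thesis by (simp add: matrix_vector_mult_basis column_def)
qed

text \<open>Cramer's rule yields some derivative \<open>D\<close> of the inverse; differentiating
  the constant product \<open>A y ** matrix_inv (A y)\<close> then determines
  \<open>D\<close>.\<close>

lemma has_derivative_matrix_inv:
  fixes A :: "'a::real_normed_vector \<Rightarrow> real^'n^'n"
  assumes U: "open U" "x \<in> U" and inv: "\<And>y. y \<in> U \<Longrightarrow> invertible (A y)"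
    and A: "(A has_derivative A') (at x)"
  shows "((\<lambda>y. matrix_inv (A y)) has_derivative
    (\<lambda>u. - (matrix_inv (A x) ** A' u ** matrix_inv (A x)))) (at x)"
proof -
  have ent: "(\<lambda>y. A y $ i $ j) differentiable (at x)" for i j
    unfolding differentiable_def
    using bounded_linear.has_derivative[OF bounded_linear_vec_nth
        bounded_linear.has_derivative[OF bounded_linear_vec_nth A]] by blast
  have det0: "det (A y) \<noteq> 0" if "y \<in> U" for y
    using inv[OF that] by (simp add: invertible_det_nz)
  have "(\<lambda>y. det (\<chi> i j. if j = k then axis l 1 $ i else A y $ i $ j) / det (A y))
      differentiable (at x)" for k l
  proof (rule differentiable_divide)
    show "(\<lambda>y. det (\<chi> i j. if j = k then axis l 1 $ i else A y $ i $ j)) differentiable (at x)"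
    proof (rule differentiable_det)
      show "(\<lambda>y. (\<chi> i j. if j = k then axis l 1 $ i else A y $ i $ j) $ i $ j) differentiable (at x)" for i j
        by (cases "j = k") (simp_all add: ent)
    qed
  qed (use det0 U ent in \<open>auto intro!: differentiable_det\<close>)
  then have "(\<lambda>y. \<chi> k l. det (\<chi> i j. if j = k then axis l 1 $ i else A y $ i $ j) / det (A y))
      differentiable (at x)"
    by (intro differentiable_vec_nthI) simp
  then obtain D where D: "((\<lambda>y. \<chi> k l. det (\<chi> i j. if j = k then axis l 1 $ i else A y $ i $ j) / det (A y))
      has_derivative D) (at x)"
    unfolding differentiable_def by blast
  have D: "((\<lambda>y. matrix_inv (A y)) has_derivative D) (at x)"
    by (rule has_derivative_transform_within_open[OF D U])
      (simp add: vec_eq_iff matrix_inv_cramer[OF det0])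
  have "((\<lambda>y. A y ** matrix_inv (A y)) has_derivative
      (\<lambda>u. A x ** D u + A' u ** matrix_inv (A x))) (at x)"
    by (rule bounded_bilinear.FDERIV[OF bounded_bilinear_matrix_mult A D])
  moreover have "((\<lambda>y. A y ** matrix_inv (A y)) has_derivative (\<lambda>u. 0)) (at x)"
    by (rule has_derivative_transform_within_open[OF has_derivative_const[of "mat 1"] U])
      (simp add: matrix_inv_right inv)
  ultimately have "(\<lambda>u. A x ** D u + A' u ** matrix_inv (A x)) = (\<lambda>u. 0)"
    by (rule has_derivative_unique)
  then have "A x ** D u + A' u ** matrix_inv (A x) = 0" for u by metis
  then have "A x ** D u = - (A' u ** matrix_inv (A x))" for u by (simp add: eq_neg_iff_add_eq_0)
  then have "matrix_inv (A x) ** (A x ** D u) = - (matrix_inv (A x) ** A' u ** matrix_inv (A x))" for u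
    by (simp add: matrix_bilinear_simps matrix_mul_assoc)
  then have "D u = - (matrix_inv (A x) ** A' u ** matrix_inv (A x))" for u
    by (simp add: matrix_mul_assoc matrix_inv_left inv U)
  then have "D = (\<lambda>u. - (matrix_inv (A x) ** A' u ** matrix_inv (A x)))" by blast
  with D show ?thesis by simp
qed

section \<open>The Levi-Civita connection in matrix form\<close>

lemma inner_matrix_vector_mult_left: "(M *v u) \<bullet> v = u \<bullet> (transpose M *v v)" for M :: "real^'n^'m"
  using dot_lmul_matrix[of u "transpose M" v] by simp

lemma matrix_eqI_inner:
  fixes A B :: "real^'n^'m"
  assumes "\<And>u v. u \<bullet> (A *v v) = u \<bullet> (B *v v)"
  shows "A = B"
proof -
  have "A *v v = B *v v" for v using assms[of _ v] vector_eq_ldot by blast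
  then show ?thesis by (simp add: matrix_eq)
qed

context
  fixes U :: "(real^'n::finite) set" and g :: "'n metric_field"
  assumes g: "riemannian_metric_on U g" and U: "open U"
begin

lemma riemannian_metric_eqI:
  assumes "x \<in> U" "\<And>z. g x a z = g x b z"
  shows "a = b"
proof -
  have "bilinear (g x)" using g assms(1) by (simp add: riemannian_metric_on_def)
  then have "g x (a - b) (a - b) = 0" using assms(2) by (simp add: bilinear_lsub)
  moreover have "a - b \<noteq> 0 \<Longrightarrow> 0 < g x (a - b) (a - b)"
    using g assms(1) unfolding riemannian_metric_on_def by blast
  ultimately show ?thesis by fastforce
qed

lemma metric_gram:
  assumes "x \<in> U"
  shows "g x u v = u \<bullet> (gram (g x) *v v)"
  using gram_works g assms by (auto simp: riemannian_metric_on_def)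

lemma transpose_gram:
  assumes "x \<in> U"
  shows "transpose (gram (g x)) = gram (g x)"
  using g assms by (simp add: riemannian_metric_on_def vec_eq_iff transpose_def gram_def)

lemma invertible_gram:
  assumes "x \<in> U"
  shows "invertible (gram (g x))"
proof -
  have "inj ((*v) (gram (g x)))"
  proof (rule injI)
    fix a b assume "gram (g x) *v a = gram (g x) *v b"
    then have "g x a z = g x b z" for z
      using metric_gram[OF assms, of z a] metric_gram[OF assms, of z b] g assms
      by (simp add: riemannian_metric_on_def)
    then show "a = b" using riemannian_metric_eqI assms by blast
  qed
  then show ?thesis
    using matrix_left_invertible_injective[of "gram (g x)"] by (simp add: invertible_left_inverse)
qed

text \<open>Transposing \<open>G ** H = mat 1\<close> with \<open>G\<close> symmetric shows that the
  transposed inverse is again a left inverse of \<open>G\<close>.\<close>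

lemma transpose_matrix_inv_gram:
  assumes "x \<in> U"
  shows "transpose (matrix_inv (gram (g x))) = matrix_inv (gram (g x))"
proof -
  let ?G = "gram (g x)"
  have "transpose (matrix_inv ?G) ** ?G = mat 1"
    using arg_cong[OF matrix_inv_right[OF invertible_gram[OF assms]], of transpose]
    by (simp add: matrix_transpose_mul transpose_gram[OF assms])
  then have "transpose (matrix_inv ?G) ** ?G ** matrix_inv ?G = matrix_inv ?G" by simp
  then show ?thesis
    by (simp add: matrix_mul_assoc[symmetric] matrix_inv_right[OF invertible_gram[OF assms]])
qed

lemma has_derivative_gram:
  assumes "x \<in> U"
  shows "((\<lambda>y. gram (g y)) has_derivative frechet_derivative (\<lambda>y. gram (g y)) (at x)) (at x)"
proof -
  have "Ck_on (Suc 0) U (\<lambda>y. g y u v)" for u v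
    using g unfolding riemannian_metric_on_def smooth_on_def by blast
  then have "(\<lambda>y. g y u v) differentiable (at x)" for u v using assms by simp
  then have "(\<lambda>y. gram (g y)) differentiable (at x)"
    unfolding gram_def by (intro differentiable_vec_nthI) simp
  then show ?thesis by (simp add: frechet_derivative_works)
qed

text \<open>All three terms of the Koszul formula become values of one matrix-valued derivative,
  from which linearity in each argument can be read off.\<close>

lemma frechet_derivative_metric:
  assumes "x \<in> U"
  shows "frechet_derivative (\<lambda>y. g y u v) (at x) w =
    u \<bullet> (frechet_derivative (\<lambda>y. gram (g y)) (at x) w *v v)"
proof -
  have "((\<lambda>y. u \<bullet> (gram (g y) *v v)) has_derivative
      (\<lambda>w. u \<bullet> (frechet_derivative (\<lambda>y. gram (g y)) (at x) w *v v))) (at x)"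
    by (intro has_derivative_inner_right has_derivative_gram assms
        bounded_linear.has_derivative[OF bounded_bilinear.bounded_linear_left[OF bounded_bilinear_matrix_vector_mult]])
  then have "((\<lambda>y. g y u v) has_derivative
      (\<lambda>w. u \<bullet> (frechet_derivative (\<lambda>y. gram (g y)) (at x) w *v v))) (at x)"
    by (rule has_derivative_transform_within_open[OF _ U assms]) (simp add: metric_gram)
  then show ?thesis by (metis frechet_derivative_at)
qed

text \<open>The Christoffel map is given by a definite description, so its linearity is checked by
  pairing with an arbitrary \<open>z\<close> and using the Koszul formula. One argument suffices
  because the map is symmetric.\<close>

lemma bilinear_christoffel:
  assumes x: "x \<in> U"
  shows "bilinear (christoffel g x)"
proof -
  note koszul = christoffel_koszul[OF g U x, unfolded frechet_derivative_metric[OF x]]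
  note lin = has_derivative_linear[OF has_derivative_gram[OF x]]
  have bil: "bilinear (g x)" using g x by (simp add: riemannian_metric_on_def)
  have lin2: "linear (christoffel g x u)" for u
  proof (rule linearI; rule riemannian_metric_eqI[OF x])
    fix v w z and c :: real
    have "2 * g x (christoffel g x u (v + w)) z = 2 * g x (christoffel g x u v + christoffel g x u w) z"
      unfolding bilinear_ladd[OF bil] distrib_left koszul
      by (simp add: linear_add[OF lin] matrix_bilinear_simps inner_add)
    then show "g x (christoffel g x u (v + w)) z = g x (christoffel g x u v + christoffel g x u w) z"
      by simp
    have "2 * g x (christoffel g x u (c *\<^sub>R v)) z = c * (2 * g x (christoffel g x u v) z)"
      unfolding koszul by (simp add: linear_cmul[OF lin] matrix_bilinear_simps algebra_simps)
    then show "g x (christoffel g x u (c *\<^sub>R v)) z = g x (c *\<^sub>R christoffel g x u v) z"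
      by (simp add: bilinear_lmul[OF bil])
  qed
  moreover have "(\<lambda>u. christoffel g x u v) = christoffel g x v" for v
    by (rule ext) (rule christoffel_sym[OF g U x])
  ultimately show ?thesis by (simp add: bilinear_def)
qed

text \<open>The matrix form of \<open>\<nabla>g = 0\<close>.\<close>

lemma frechet_derivative_gram:
  assumes x: "x \<in> U"
  shows "frechet_derivative (\<lambda>y. gram (g y)) (at x) u =
    transpose (matrix (christoffel g x u)) ** gram (g x) + gram (g x) ** matrix (christoffel g x u)"
proof (rule matrix_eqI_inner)
  fix a c :: "real^'n"
  have \<Gamma>: "christoffel g x u v = matrix (christoffel g x u) *v v" for v
    using bilinear_christoffel[OF x] by (simp add: bilinear_def matrix_works)
  have "a \<bullet> (frechet_derivative (\<lambda>y. gram (g y)) (at x) u *v c) =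
      g x (matrix (christoffel g x u) *v a) c + g x a (matrix (christoffel g x u) *v c)"
    using frechet_derivative_metric[OF x, of a c u] christoffel_metric[OF g U x, of a c u]
    by (simp add: \<Gamma>[of a] \<Gamma>[of c])
  also have "\<dots> = a \<bullet> (transpose (matrix (christoffel g x u)) *v (gram (g x) *v c)) +
      a \<bullet> (gram (g x) *v (matrix (christoffel g x u) *v c))"
    by (simp only: metric_gram[OF x] inner_matrix_vector_mult_left)
  also have "\<dots> = a \<bullet>
    ((transpose (matrix (christoffel g x u)) ** gram (g x) + gram (g x) ** matrix (christoffel g x u)) *v c)"
    by (simp only: matrix_vector_mul_assoc matrix_bilinear_simps inner_right_distrib)
  finally show "a \<bullet> (frechet_derivative (\<lambda>y. gram (g y)) (at x) u *v c) = a \<bullet>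
    ((transpose (matrix (christoffel g x u)) ** gram (g x) + gram (g x) ** matrix (christoffel g x u)) *v c)" .
qed

text \<open>The inverse metric is parallel too: insert the derivative of the Gram matrix into
  \<open>- H ** dG ** H\<close> and cancel each \<open>G\<close> against an adjacent
  \<open>H\<close>.\<close>

lemma has_derivative_matrix_inv_gram:
  assumes x: "x \<in> U"
  defines "H \<equiv> matrix_inv (gram (g x))"
  shows "((\<lambda>y. matrix_inv (gram (g y))) has_derivative
    (\<lambda>u. - (H ** transpose (matrix (christoffel g x u)) + matrix (christoffel g x u) ** H))) (at x)"
proof -
  have GH: "gram (g x) ** H = mat 1" "H ** gram (g x) = mat 1"
    using matrix_inv_right_left[OF invertible_gram[OF x]] by (simp_all add: H_def)
  have "H ** frechet_derivative (\<lambda>y. gram (g y)) (at x) u ** H =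
      H ** transpose (matrix (christoffel g x u)) ** (gram (g x) ** H) +
      (H ** gram (g x)) ** matrix (christoffel g x u) ** H" for u
    by (simp only: frechet_derivative_gram[OF x] matrix_bilinear_simps matrix_mul_assoc)
  then have "H ** frechet_derivative (\<lambda>y. gram (g y)) (at x) u ** H =
      H ** transpose (matrix (christoffel g x u)) + matrix (christoffel g x u) ** H" for u
    by (simp only: GH matrix_mul_lid matrix_mul_rid)
  with has_derivative_matrix_inv[OF U x invertible_gram has_derivative_gram[OF x]]
  show ?thesis unfolding H_def by simp
qed

end

section \<open>The covariant derivative of the almost complex structure\<close>

text \<open>The covariant derivative \<open>\<nabla>_u J = dJ(u) + [\<Gamma>(u), J]\<close> of an
  endomorphism field, as a matrix.\<close>

definition nabla_endo :: "'n::finite metric_field \<Rightarrow> 'n endo_field \<Rightarrow> real^'n \<Rightarrow> real^'n \<Rightarrow> real^'n^'n"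
  where "nabla_endo h J x u = frechet_derivative (\<lambda>y. matrix (J y)) (at x) u
    + matrix (christoffel h x u) ** matrix (J x) - matrix (J x) ** matrix (christoffel h x u)"

context
  fixes U :: "(real^'n::finite) set" and h :: "'n metric_field" and J :: "'n endo_field"
  assumes hJ: "almost_hermitian_on U h J" and U: "open U"
begin

lemma hermitian_metric: "riemannian_metric_on U h"
  using hJ by (simp add: almost_hermitian_on_def)

lemma linear_complex_structure: "x \<in> U \<Longrightarrow> linear (J x)"
  using hJ by (simp add: almost_hermitian_on_def almost_complex_structure_on_def)

lemma matrix_complex_structure_vector: "x \<in> U \<Longrightarrow> matrix (J x) *v v = J x v"
  using linear_complex_structure by (simp add: matrix_works)

lemma matrix_complex_structure_square:
  assumes "x \<in> U"
  shows "matrix (J x) ** matrix (J x) = - mat 1"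
proof -
  have "J x (J x v) = - v" for v
    using hJ assms by (simp add: almost_hermitian_on_def almost_complex_structure_on_def)
  then have "(matrix (J x) ** matrix (J x)) *v v = (- mat 1) *v v" for v
    using assms by (simp only: matrix_vector_mul_assoc[symmetric] matrix_complex_structure_vector
        matrix_bilinear_simps matrix_vector_mul_lid)
  then show ?thesis by (simp add: matrix_eq)
qed

text \<open>\<open>J\<close> is skew for the metric, stated on the inverse Gram matrix. From
  \<open>J^T G J = G\<close> and \<open>J^2 = -1\<close> follows \<open>- J^T G = G J\<close>;
  multiplying by the inverse of \<open>G\<close> on both sides gives the claim.\<close>

lemma matrix_inv_gram_complex_structure:
  assumes "x \<in> U"
  shows "matrix_inv (gram (h x)) ** transpose (matrix (J x)) = - (matrix (J x) ** matrix_inv (gram (h x)))"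
proof -
  let ?J = "matrix (J x)" and ?G = "gram (h x)"
  have inv: "h x (J x u) (J x v) = h x u v" for u v
    using hJ assms by (simp add: almost_hermitian_on_def)
  have "transpose ?J ** ?G ** ?J = ?G"
  proof (rule matrix_eqI_inner)
    fix u v
    have "u \<bullet> ((transpose ?J ** ?G ** ?J) *v v) = (?J *v u) \<bullet> (?G *v (?J *v v))"
      by (simp only: inner_matrix_vector_mult_left matrix_vector_mul_assoc matrix_mul_assoc)
    then show "u \<bullet> ((transpose ?J ** ?G ** ?J) *v v) = u \<bullet> (?G *v v)"
      using inv[of u v] metric_gram[OF hermitian_metric U assms] assms
      by (simp only: matrix_complex_structure_vector)
  qed
  then have "transpose ?J ** ?G ** (?J ** ?J) = ?G ** ?J" by (simp only: matrix_mul_assoc)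
  then have "- (transpose ?J ** ?G) = ?G ** ?J"
    by (simp only: matrix_complex_structure_square[OF assms] matrix_bilinear_simps matrix_mul_rid)
  then have "matrix_inv ?G ** (- (transpose ?J ** ?G)) ** matrix_inv ?G = 
      matrix_inv ?G ** (?G ** ?J) ** matrix_inv ?G" by simp
  then have "- (matrix_inv ?G ** transpose ?J ** (?G ** matrix_inv ?G)) =
      (matrix_inv ?G ** ?G) ** ?J ** matrix_inv ?G"
    by (simp only: matrix_mul_assoc matrix_bilinear_simps)
  then have "- (matrix_inv ?G ** transpose ?J) = ?J ** matrix_inv ?G"
    unfolding matrix_inv_right_left[OF invertible_gram[OF hermitian_metric U assms]]
        matrix_mul_lid matrix_mul_rid .
  then show ?thesis by (metis minus_minus)
qed

text \<open>By \<open>bivector_inner_wedge\<close>, the defining equation evaluates \<open>F\<close>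
  on vectors whose indices are lowered by \<open>G\<close>. Taking the arguments \<open>H a\<close>
  and \<open>H c\<close> undoes the lowering.\<close>

lemma fundamental_bivector_eq:
  assumes "x \<in> U"
  shows "fundamental_bivector h J x = matrix_inv (gram (h x)) ** transpose (matrix (J x))"
proof (rule matrix_eqI_inner)
  fix a c
  let ?F = "fundamental_bivector h J x" and ?G = "gram (h x)" and ?J = "matrix (J x)"
  let ?H = "matrix_inv ?G"
  note F = fundamental_bivector[OF hJ assms]
  have GH: "?G *v (?H *v v) = v" for v
    by (simp only: matrix_vector_mul_assoc matrix_vector_mul_lid
        matrix_inv_right_left[OF invertible_gram[OF hermitian_metric U assms]])
  have "(?G *v (?H *v a)) \<bullet> (?F *v (?G *v (?H *v c))) = h x (J x (?H *v a)) (?H *v c)"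
    by (rule F(2)[unfolded bivector_inner_wedge[OF F(1)]])
  also have "\<dots> = (?J *v (?H *v a)) \<bullet> (?G *v (?H *v c))"
    using assms by (simp only: metric_gram[OF hermitian_metric U assms] matrix_complex_structure_vector)
  finally have "a \<bullet> (?F *v c) = (?J *v (?H *v a)) \<bullet> c" by (simp only: GH)
  also have "\<dots> = a \<bullet> ((?H ** transpose ?J) *v c)"
    by (simp only: inner_matrix_vector_mult_left matrix_vector_mul_assoc[symmetric]
        transpose_matrix_inv_gram[OF hermitian_metric U assms])
  finally show "a \<bullet> (?F *v c) = a \<bullet> ((?H ** transpose ?J) *v c)" .
qed

lemma has_derivative_complex_structure:
  assumes "x \<in> U"
  shows "((\<lambda>y. matrix (J y)) has_derivative frechet_derivative (\<lambda>y. matrix (J y)) (at x)) (at x)"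
proof -
  have "Ck_on (Suc 0) U (\<lambda>y. J y v)" for v
    using hJ unfolding almost_hermitian_on_def almost_complex_structure_on_def smooth_on_def by blast
  then have "(\<lambda>y. J y v) differentiable (at x)" for v using assms by simp
  then have "((\<lambda>y. J y (axis j 1)) has_derivative frechet_derivative (\<lambda>y. J y (axis j 1)) (at x)) (at x)" for j
    by (simp add: frechet_derivative_works)
  then have "((\<lambda>y. matrix (J y)) has_derivative
      (\<lambda>u. \<chi> i j. frechet_derivative (\<lambda>y. J y (axis j 1)) (at x) u $ i)) (at x)"
    by (rule has_derivative_matrix)
  then have "(\<lambda>y. matrix (J y)) differentiable (at x)"
    unfolding differentiable_def by blast
  then show ?thesis by (simp add: frechet_derivative_works)
qed

text \<open>Differentiate \<open>J^2 = -1\<close> for the part \<open>dJ\<close>; the commutator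
  \<open>[\<Gamma>, J]\<close> anticommutes with \<open>J\<close> because \<open>J^2\<close> is a
  scalar.\<close>

lemma nabla_endo_anticommute:
  assumes "x \<in> U"
  shows "nabla_endo h J x u ** matrix (J x) = - (matrix (J x) ** nabla_endo h J x u)"
proof -
  let ?J = "matrix (J x)" and ?D = "frechet_derivative (\<lambda>y. matrix (J y)) (at x)"
    and ?\<Gamma> = "matrix (christoffel h x u)"
  have "((\<lambda>y. matrix (J y) ** matrix (J y)) has_derivative (\<lambda>u. ?J ** ?D u + ?D u ** ?J)) (at x)"
    by (intro bounded_bilinear.FDERIV[OF bounded_bilinear_matrix_mult]
        has_derivative_complex_structure assms)
  moreover have "((\<lambda>y. matrix (J y) ** matrix (J y)) has_derivative (\<lambda>u. 0)) (at x)"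
    by (rule has_derivative_transform_within_open[OF has_derivative_const[of "- mat 1"] U assms])
      (simp only: matrix_complex_structure_square)
  ultimately have "(\<lambda>u. ?J ** ?D u + ?D u ** ?J) = (\<lambda>u. 0)" by (rule has_derivative_unique)
  then have "?J ** ?D u + ?D u ** ?J = 0" by metis
  then have DJ: "?D u ** ?J = - (?J ** ?D u)" by (simp add: eq_neg_iff_add_eq_0 add.commute)
  have "?\<Gamma> ** ?J ** ?J = - ?\<Gamma>" "?J ** ?J ** ?\<Gamma> = - ?\<Gamma>"
    by (simp_all only: matrix_mul_assoc[symmetric, of ?\<Gamma>] matrix_complex_structure_square[OF assms]
      matrix_bilinear_simps matrix_mul_lid matrix_mul_rid)
  then show ?thesis
    by (simp add: nabla_endo_def matrix_bilinear_simps matrix_mul_assoc DJ)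
qed

text \<open>The Leibniz rule for \<open>F = H J^T\<close> with \<open>H\<close> parallel: the
  Christoffel terms from differentiating \<open>H\<close> combine with those of
  \<open>nabla_bivector\<close> into the commutator in \<open>\<nabla>J\<close>.\<close>

lemma nabla_bivector_fundamental:
  assumes x: "x \<in> U"
  shows "nabla_bivector h (fundamental_bivector h J) x u =
    matrix_inv (gram (h x)) ** transpose (nabla_endo h J x u)"
proof -
  let ?J = "matrix (J x)" and ?D = "frechet_derivative (\<lambda>y. matrix (J y)) (at x)"
    and ?\<Gamma> = "\<lambda>u. matrix (christoffel h x u)" and ?H = "matrix_inv (gram (h x))"
  have dJ: "((\<lambda>y. transpose (matrix (J y))) has_derivative (\<lambda>u. transpose (?D u))) (at x)"
    by (rule bounded_linear.has_derivative[OF bounded_linear_transpose])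
      (rule has_derivative_complex_structure[OF x])
  have dH: "((\<lambda>y. matrix_inv (gram (h y))) has_derivative
      (\<lambda>u. - (?H ** transpose (?\<Gamma> u) + ?\<Gamma> u ** ?H))) (at x)"
    by (rule has_derivative_matrix_inv_gram[OF hermitian_metric U x])
  have "((\<lambda>y. matrix_inv (gram (h y)) ** transpose (matrix (J y))) has_derivative
      (\<lambda>u. ?H ** transpose (?D u) + - (?H ** transpose (?\<Gamma> u) + ?\<Gamma> u ** ?H) ** transpose ?J)) (at x)"
    by (rule bounded_bilinear.FDERIV[OF bounded_bilinear_matrix_mult dH dJ])
  then have "(fundamental_bivector h J has_derivative
      (\<lambda>u. ?H ** transpose (?D u) + - (?H ** transpose (?\<Gamma> u) + ?\<Gamma> u ** ?H) ** transpose ?J)) (at x)"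
    by (rule has_derivative_transform_within_open[OF _ U x]) (simp only: fundamental_bivector_eq)
  then have "frechet_derivative (fundamental_bivector h J) (at x) =
      (\<lambda>u. ?H ** transpose (?D u) + - (?H ** transpose (?\<Gamma> u) + ?\<Gamma> u ** ?H) ** transpose ?J)"
    by (rule frechet_derivative_at[symmetric])
  then show ?thesis
    by (simp add: nabla_bivector_def nabla_endo_def fundamental_bivector_eq[OF x]
        matrix_bilinear_simps matrix_transpose_mul matrix_mul_assoc)
qed

lemma linear_nabla_endo:
  assumes x: "x \<in> U"
  shows "linear (nabla_endo h J x)"
proof (rule linearI)
  have lin: "linear (\<lambda>u. christoffel h x u v)" for v
    using bilinear_christoffel[OF hermitian_metric U x] by (simp add: bilinear_def)
  have m: "matrix (christoffel h x (a + b)) = matrix (christoffel h x a) + matrix (christoffel h x b)"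
    "matrix (christoffel h x (c *\<^sub>R a)) = c *\<^sub>R matrix (christoffel h x a)" for a b c
    by (simp_all add: matrix_def vec_eq_iff linear_add[OF lin] linear_cmul[OF lin])
  note linD = has_derivative_linear[OF has_derivative_complex_structure[OF x]]
  fix a b :: "real^'n" and c :: real
  show "nabla_endo h J x (a + b) = nabla_endo h J x a + nabla_endo h J x b"
    by (simp add: nabla_endo_def m matrix_bilinear_simps linear_add[OF linD])
  show "nabla_endo h J x (c *\<^sub>R a) = c *\<^sub>R nabla_endo h J x a"
    by (simp add: nabla_endo_def m matrix_bilinear_simps linear_cmul[OF linD] scaleR_add_right
        scaleR_diff_right)
qed

end

section \<open>The tensor D2F\<close>

text \<open>A real expression for \<open>D2F\<close>: in the expanded product of the three
  projections only terms with no factor or two factors of the structure survive. They are grouped by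
  whether it acts on the first index.\<close>

lemma tensor_map_projections:
  fixes T :: "'n \<Rightarrow> real^'n^'n::finite" and J :: "real^'n \<Rightarrow> real^'n"
  defines "t \<equiv> \<chi> k i j. complex_of_real (T k $ i $ j)" and "M \<equiv> matrix J"
  shows "(tensor_map (proj10 J) (proj01 J) (proj01 J) t +
      tensor_map (proj01 J) (proj10 J) (proj10 J) t) $ a $ b $ c =
    complex_of_real (1/4 * (\<Sum>k\<in>UNIV. mat 1 $ a $ k * (T k - M ** T k ** transpose M) $ b $ c +
      M $ a $ k * (M ** T k + T k ** transpose M) $ b $ c))"
proof -
  \<comment> \<open>Acting on both indices of a bivector is multiplication from the left and by a
    transpose from the right. Writing the Kronecker delta as \<open>mat 1\<close> below lets this
    cover untouched indices too.\<close>
  have act: "(\<Sum>i\<in>UNIV. \<Sum>j\<in>UNIV. Q $ b $ i * R $ c $ j * A $ i $ j) = (Q ** A ** transpose R) $ b $ c"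
    for Q R A :: "real^'n^'n"
  proof -
    have "(Q ** A ** transpose R) $ b $ c =
        (\<Sum>j\<in>UNIV. \<Sum>i\<in>UNIV. Q $ b $ i * A $ i $ j * R $ c $ j)"
      by (simp add: matrix_matrix_mult_def transpose_def sum_distrib_right)
    also have "\<dots> = (\<Sum>i\<in>UNIV. \<Sum>j\<in>UNIV. Q $ b $ i * A $ i $ j * R $ c $ j)"
      by (rule sum.swap)
    finally show ?thesis by (simp add: mult_ac)
  qed
  have I: "of_bool (i = j) = complex_of_real (mat 1 $ i $ j)" for i j :: 'n
    by (simp add: mat_def)
  \<comment> \<open>The two tensors are complex conjugate: their sum is twice the real part of the product of the
    projections.\<close>
  have point: "((d1 - \<i> * m1) / 2) * ((d2 + \<i> * m2) / 2) * ((d3 + \<i> * m3) / 2) * r +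
      ((d1 + \<i> * m1) / 2) * ((d2 - \<i> * m2) / 2) * ((d3 - \<i> * m3) / 2) * r =
      complex_of_real (1/4 * (d1 * (d2 * d3 * r) - d1 * (m2 * m3 * r) + m1 * (m2 * d3 * r) + m1 * (d2 * m3 * r)))"
    for d1 d2 d3 m1 m2 m3 r :: real
    by (simp add: complex_eq_iff field_simps)
  have "(tensor_map (proj10 J) (proj01 J) (proj01 J) t +
      tensor_map (proj01 J) (proj10 J) (proj10 J) t) $ a $ b $ c =
    (\<Sum>k\<in>UNIV. \<Sum>i\<in>UNIV. \<Sum>j\<in>UNIV. complex_of_real (1/4 *
      (mat 1 $ a $ k * (mat 1 $ b $ i * mat 1 $ c $ j * T k $ i $ j)
      - mat 1 $ a $ k * (M $ b $ i * M $ c $ j * T k $ i $ j)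
      + M $ a $ k * (M $ b $ i * mat 1 $ c $ j * T k $ i $ j)
      + M $ a $ k * (mat 1 $ b $ i * M $ c $ j * T k $ i $ j))))"
    unfolding point[symmetric]
    by (simp add: tensor_map_def proj10_def proj01_def t_def M_def I sum.distrib)
  also have "\<dots> = complex_of_real (1/4 * (\<Sum>k\<in>UNIV. 
      mat 1 $ a $ k * (\<Sum>i\<in>UNIV. \<Sum>j\<in>UNIV. mat 1 $ b $ i * mat 1 $ c $ j * T k $ i $ j)
      - mat 1 $ a $ k * (\<Sum>i\<in>UNIV. \<Sum>j\<in>UNIV. M $ b $ i * M $ c $ j * T k $ i $ j)
      + M $ a $ k * (\<Sum>i\<in>UNIV. \<Sum>j\<in>UNIV. M $ b $ i * mat 1 $ c $ j * T k $ i $ j)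
      + M $ a $ k * (\<Sum>i\<in>UNIV. \<Sum>j\<in>UNIV. mat 1 $ b $ i * M $ c $ j * T k $ i $ j)))"
    by (simp only: of_real_sum[symmetric] sum_distrib_left sum.distrib[symmetric]
        sum_subtractf[symmetric])
  finally show ?thesis
    unfolding act by (simp add: algebra_simps)
qed

section \<open>Traces and linear substitutions\<close>

lemma linear_matrix_axis:
  fixes M :: "real^'n^'m"
  assumes "linear f"
  shows "f (M *v axis j 1) = (\<Sum>k\<in>UNIV. M $ k $ j *\<^sub>R f (axis k 1))"
proof -
  have "M *v axis j 1 = (\<Sum>k\<in>UNIV. M $ k $ j *\<^sub>R axis k 1)"
    using basis_expansion[of "column j M"]
    by (simp add: matrix_vector_mult_basis scalar_mult_eq_scaleR column_def)
  then show ?thesis by (simp add: linear_sum[OF assms] linear_cmul[OF assms])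
qed

lemma metric_trace_add:
  "metric_trace b (\<lambda>u v. K u v + L u v) = metric_trace b K + metric_trace b L"
  by (simp add: metric_trace_def scaleR_add_right sum.distrib)

lemma metric_trace_linear:
  assumes "linear f"
  shows "metric_trace b (\<lambda>u v. f (K u v)) = f (metric_trace b K)"
  by (simp add: metric_trace_def linear_sum[OF assms] linear_cmul[OF assms])

lemma metric_trace_swap:
  assumes "transpose (matrix_inv (gram b)) = matrix_inv (gram b)"
  shows "metric_trace b (\<lambda>u v. K v u) = metric_trace b K"
proof -
  have "matrix_inv (gram b) $ i $ j = matrix_inv (gram b) $ j $ i" for i j
    using arg_cong[OF assms, of "\<lambda>A. A $ j $ i"] by (simp add: transpose_def)
  then have "metric_trace b (\<lambda>u v. K v u) =
      (\<Sum>i\<in>UNIV. \<Sum>j\<in>UNIV. matrix_inv (gram b) $ j $ i *\<^sub>R K (axis j 1) (axis i 1))"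
    by (simp add: metric_trace_def)
  also have "\<dots> = metric_trace b K"
    unfolding metric_trace_def by (rule sum.swap)
  finally show ?thesis .
qed

text \<open>A matrix in an argument of \<open>K\<close> can be absorbed into the inverse Gram
  matrix. Together with the analogue for the second argument, this turns relations between
  \<open>J\<close> and the inverse metric into relations between traces.\<close>

lemma metric_trace_matrix_left:
  assumes "bilinear K"
  shows "metric_trace b (\<lambda>u v. K (M *v u) v) =
    (\<Sum>i\<in>UNIV. \<Sum>j\<in>UNIV. (M ** matrix_inv (gram b)) $ i $ j *\<^sub>R K (axis i 1) (axis j 1))"
proof -
  have lin: "linear (\<lambda>u. K u v)" for v using assms by (simp add: bilinear_def)
  have "metric_trace b (\<lambda>u v. K (M *v u) v) = (\<Sum>i\<in>UNIV. \<Sum>j\<in>UNIV. \<Sum>k\<in>UNIV.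
      (M $ k $ i * matrix_inv (gram b) $ i $ j) *\<^sub>R K (axis k 1) (axis j 1))"
    unfolding metric_trace_def linear_matrix_axis[OF lin]
    by (simp add: scaleR_sum_right mult.commute)
  also have "\<dots> = (\<Sum>j\<in>UNIV. \<Sum>i\<in>UNIV. \<Sum>k\<in>UNIV.
      (M $ k $ i * matrix_inv (gram b) $ i $ j) *\<^sub>R K (axis k 1) (axis j 1))"
    by (rule sum.swap)
  also have "\<dots> = (\<Sum>j\<in>UNIV. \<Sum>k\<in>UNIV. \<Sum>i\<in>UNIV.
      (M $ k $ i * matrix_inv (gram b) $ i $ j) *\<^sub>R K (axis k 1) (axis j 1))"
    by (rule sum.cong[OF refl]) (rule sum.swap)
  also have "\<dots> = (\<Sum>k\<in>UNIV. \<Sum>j\<in>UNIV. \<Sum>i\<in>UNIV.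
      (M $ k $ i * matrix_inv (gram b) $ i $ j) *\<^sub>R K (axis k 1) (axis j 1))"
    by (rule sum.swap)
  finally show ?thesis by (simp add: matrix_matrix_mult_def scaleR_sum_left)
qed

lemma metric_trace_matrix_right:
  assumes "bilinear K"
  shows "metric_trace b (\<lambda>u v. K u (M *v v)) =
    (\<Sum>i\<in>UNIV. \<Sum>j\<in>UNIV. (matrix_inv (gram b) ** transpose M) $ i $ j *\<^sub>R K (axis i 1) (axis j 1))"
proof -
  have lin: "linear (K u)" for u using assms by (simp add: bilinear_def)
  have "metric_trace b (\<lambda>u v. K u (M *v v)) = (\<Sum>i\<in>UNIV. \<Sum>j\<in>UNIV. \<Sum>k\<in>UNIV.
      (matrix_inv (gram b) $ i $ j * M $ k $ j) *\<^sub>R K (axis i 1) (axis k 1))"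
    unfolding metric_trace_def linear_matrix_axis[OF lin]
    by (simp add: scaleR_sum_right)
  also have "\<dots> = (\<Sum>i\<in>UNIV. \<Sum>k\<in>UNIV. \<Sum>j\<in>UNIV.
      (matrix_inv (gram b) $ i $ j * M $ k $ j) *\<^sub>R K (axis i 1) (axis k 1))"
    by (rule sum.cong[OF refl]) (rule sum.swap)
  finally show ?thesis by (simp add: matrix_matrix_mult_def transpose_def scaleR_sum_left)
qed

text \<open>Associativity for matrices acting on families of vectors; it is used to compose the
  raising and lowering of the derivative index.\<close>

lemma sum_matrix_mult_scaleR:
  fixes A B :: "real^'n^'n" and Y :: "'n::finite \<Rightarrow> 'a::real_vector"
  shows "(\<Sum>k\<in>UNIV. A $ a $ k *\<^sub>R (\<Sum>l\<in>UNIV. B $ k $ l *\<^sub>R Y l)) = (\<Sum>l\<in>UNIV. (A ** B) $ a $ l *\<^sub>R Y l)"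
proof -
  have "(\<Sum>k\<in>UNIV. A $ a $ k *\<^sub>R (\<Sum>l\<in>UNIV. B $ k $ l *\<^sub>R Y l)) =
      (\<Sum>k\<in>UNIV. \<Sum>l\<in>UNIV. (A $ a $ k * B $ k $ l) *\<^sub>R Y l)"
    by (simp add: scaleR_sum_right)
  also have "\<dots> = (\<Sum>l\<in>UNIV. \<Sum>k\<in>UNIV. (A $ a $ k * B $ k $ l) *\<^sub>R Y l)"
    by (rule sum.swap)
  finally show ?thesis by (simp add: matrix_matrix_mult_def scaleR_sum_left)
qed

lemma sum_mat_1_scaleR: "(\<Sum>l\<in>UNIV. mat 1 $ a $ l *\<^sub>R Y l) = Y a"
  for Y :: "'n::finite \<Rightarrow> 'a::real_vector"
proof -
  have "(\<Sum>l\<in>UNIV. mat 1 $ a $ l *\<^sub>R Y l) = (\<Sum>l\<in>UNIV. if a = l then Y l else 0)"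
    by (rule sum.cong) (auto simp: mat_def)
  then show ?thesis by simp
qed

section \<open>\<open>D2F\<close> in terms of the covariant derivative of \<open>J\<close>\<close>

context
  fixes U :: "(real^'n::finite) set" and h :: "'n metric_field" and J :: "'n endo_field" and x :: "real^'n"
  assumes hJ: "almost_hermitian_on U h J" and U: "open U" and x: "x \<in> U"
begin

private lemma gram_inv:
  "gram (h x) ** matrix_inv (gram (h x)) = mat 1" "matrix_inv (gram (h x)) ** gram (h x) = mat 1"
  by (rule matrix_inv_right_left[OF invertible_gram[OF hermitian_metric[OF hJ U] U x]])+

text \<open>Because \<open>\<nabla>J\<close> anticommutes with \<open>J\<close>, the bivectors
  \<open>\<nabla>_u F\<close> have no (1,1)-part. The two projections on the bivector slots
  therefore collapse, and only the action of \<open>J\<close> on the derivative slot remains, which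
  gives the second term of \<open>W\<close>.\<close>

lemma D2F_nabla_endo:
  defines "H \<equiv> matrix_inv (gram (h x))"
  defines "W \<equiv> \<lambda>u. nabla_endo h J x u + nabla_endo h J x (J x u) ** matrix (J x)"
  shows "D2F h J x $ a $ b $ c = complex_of_real
    (1/2 * (\<Sum>l\<in>UNIV. H $ a $ l *\<^sub>R (H ** transpose (W (axis l 1)))) $ b $ c)"
proof -
  let ?J = "matrix (J x)" and ?N = "nabla_endo h J x"
  define X where "X u = H ** transpose (?N u)" for u
  define T where "T k = (\<Sum>l\<in>UNIV. H $ k $ l *\<^sub>R X (axis l 1))" for k
  have linX: "linear X"
    by (rule linearI)
      (simp_all add: X_def matrix_bilinear_simps linear_add[OF linear_nabla_endo[OF hJ U x]]
        linear_cmul[OF linear_nabla_endo[OF hJ U x]])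
  have HJ: "H ** transpose ?J = - (?J ** H)"
    unfolding H_def by (rule matrix_inv_gram_complex_structure[OF hJ U x])
  \<comment> \<open>Skewness of \<open>J\<close> moves it through \<open>H\<close>, and
    anticommutation then moves it past \<open>\<nabla>_u J\<close>; the two signs cancel.\<close>
  have JX: "?J ** X u = H ** transpose (?J ** ?N u)" for u
  proof -
    have "?J ** X u = - (H ** transpose ?J ** transpose (?N u))"
      unfolding HJ by (simp add: X_def matrix_bilinear_simps matrix_mul_assoc)
    also have "\<dots> = H ** transpose (- (?N u ** ?J))"
      by (simp add: matrix_bilinear_simps matrix_transpose_mul matrix_mul_assoc)
    finally show ?thesis by (simp add: nabla_endo_anticommute[OF hJ U x])
  qed
  have XJ: "X u ** transpose ?J = ?J ** X u" for u
    unfolding JX by (simp add: X_def matrix_transpose_mul matrix_mul_assoc)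
  have JT: "?J ** T k = (\<Sum>l\<in>UNIV. H $ k $ l *\<^sub>R (?J ** X (axis l 1)))" for k
    unfolding T_def
    by (simp add: bounded_bilinear.sum_right[OF bounded_bilinear_matrix_mult] matrix_bilinear_simps)
  have TJ: "T k ** transpose ?J = ?J ** T k" for k
    unfolding JT unfolding T_def
    by (simp add: bounded_bilinear.sum_left[OF bounded_bilinear_matrix_mult] matrix_bilinear_simps XJ)
  \<comment> \<open>This sign says that \<open>T k\<close> has type (2,0) + (0,2).\<close>
  have JTJ: "?J ** T k ** transpose ?J = - T k" for k
  proof -
    have "?J ** T k ** transpose ?J = (?J ** ?J) ** T k"
      by (simp only: matrix_mul_assoc[symmetric] TJ)
    also have "\<dots> = - T k"
      by (simp only: matrix_complex_structure_square[OF hJ U x] matrix_bilinear_simps matrix_mul_lid)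
    finally show ?thesis .
  qed
  have "nablaF h J x = (\<chi> k i j. complex_of_real (T k $ i $ j))"
    by (simp add: nablaF_def T_def X_def H_def vec_eq_iff nabla_bivector_fundamental[OF hJ U x])
  then have "D2F h J x $ a $ b $ c = complex_of_real (1/4 * (\<Sum>k\<in>UNIV.
      mat 1 $ a $ k * (T k - ?J ** T k ** transpose ?J) $ b $ c +
      ?J $ a $ k * (?J ** T k + T k ** transpose ?J) $ b $ c))"
    unfolding D2F_def by (simp only: tensor_map_projections)
  \<comment> \<open>Both brackets double by \<open>JTJ\<close> and \<open>TJ\<close>, turning the
    factor 1/4 into 1/2.\<close>
  also have "\<dots> = complex_of_real (1/2 *
      ((\<Sum>k\<in>UNIV. mat 1 $ a $ k *\<^sub>R T k) + (\<Sum>k\<in>UNIV. ?J $ a $ k *\<^sub>R (?J ** T k))) $ b $ c)"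
  proof -
    have "(\<Sum>k\<in>UNIV. mat 1 $ a $ k * (T k - - T k) $ b $ c + ?J $ a $ k * (?J ** T k + ?J ** T k) $ b $ c) =
        2 * ((\<Sum>k\<in>UNIV. mat 1 $ a $ k *\<^sub>R T k) + (\<Sum>k\<in>UNIV. ?J $ a $ k *\<^sub>R (?J ** T k))) $ b $ c"
      by (simp add: sum.distrib sum_distrib_left distrib_left mult_ac flip: mult_2)
    then show ?thesis unfolding JTJ TJ by simp
  qed
  also have "(\<Sum>k\<in>UNIV. mat 1 $ a $ k *\<^sub>R T k) = T a" by (rule sum_mat_1_scaleR)
  \<comment> \<open>On the raised derivative index \<open>J\<close> acts to the left of
    \<open>H\<close>. Passing it through \<open>H\<close> costs a sign and lets the next step move
    it into the argument of \<open>X\<close>.\<close>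
  also have "(\<Sum>k\<in>UNIV. ?J $ a $ k *\<^sub>R (?J ** T k)) =
      - (\<Sum>l\<in>UNIV. (H ** transpose ?J) $ a $ l *\<^sub>R (?J ** X (axis l 1)))"
    unfolding JT sum_matrix_mult_scaleR HJ by (simp add: sum_negf)
  also have "(\<Sum>l\<in>UNIV. (H ** transpose ?J) $ a $ l *\<^sub>R (?J ** X (axis l 1))) =
      (\<Sum>m\<in>UNIV. H $ a $ m *\<^sub>R (?J ** X (J x (axis m 1))))"
  proof -
    have lin: "linear (\<lambda>u. ?J ** X u)"
      by (rule linearI) (simp_all add: linear_add[OF linX] linear_cmul[OF linX] matrix_bilinear_simps)
    have "?J ** X (J x (axis m 1)) = (\<Sum>l\<in>UNIV. transpose ?J $ m $ l *\<^sub>R (?J ** X (axis l 1)))" for m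
      using linear_matrix_axis[OF lin, of ?J m]
      by (simp add: matrix_complex_structure_vector[OF hJ U x] transpose_def)
    then show ?thesis by (simp add: sum_matrix_mult_scaleR)
  qed
  also have "T a + - (\<Sum>m\<in>UNIV. H $ a $ m *\<^sub>R (?J ** X (J x (axis m 1)))) =
      (\<Sum>m\<in>UNIV. H $ a $ m *\<^sub>R (X (axis m 1) - ?J ** X (J x (axis m 1))))"
    by (simp add: T_def scaleR_diff_right sum_subtractf)
  also have "\<dots> = (\<Sum>l\<in>UNIV. H $ a $ l *\<^sub>R (H ** transpose (W (axis l 1))))"
    unfolding JX by (simp add: X_def W_def nabla_endo_anticommute[OF hJ U x] matrix_bilinear_simps)
  finally show ?thesis .
qed

text \<open>Both raisings by \<open>H\<close> in \<open>D2F_nabla_endo\<close> are invertible, so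
  \<open>D2F = 0\<close> forces \<open>W\<close> to vanish on the standard basis, hence everywhere
  by linearity.\<close>

lemma nabla_endo_symplectic12:
  assumes "D2F h J x = 0"
  shows "nabla_endo h J x u = - (nabla_endo h J x (J x u) ** matrix (J x))"
proof -
  let ?G = "gram (h x)"
  let ?H = "matrix_inv ?G"
  define W where "W u = nabla_endo h J x u + nabla_endo h J x (J x u) ** matrix (J x)" for u
  have half: "r = 0" if "complex_of_real (1/2 * r) = 0" for r
    using that by simp
  have "complex_of_real (1/2 * (\<Sum>l\<in>UNIV. ?H $ a $ l *\<^sub>R (?H ** transpose (W (axis l 1)))) $ b $ c) = 0" for a b c
    using D2F_nabla_endo[of a b c] assms unfolding W_def by simp
  then have "(\<Sum>l\<in>UNIV. ?H $ a $ l *\<^sub>R (?H ** transpose (W (axis l 1)))) $ b $ c = 0" for a b c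
    by (rule half)
  then have *: "(\<Sum>l\<in>UNIV. ?H $ a $ l *\<^sub>R (?H ** transpose (W (axis l 1)))) = 0" for a
    by (simp only: vec_eq_iff zero_index simp_thms)
  \<comment> \<open>Inserting \<open>G ** H = mat 1\<close> lowers the derivative index, exhibiting
    each term as a combination of the sums that vanish by \<open>*\<close>.\<close>
  have "?H ** transpose (W (axis l 1)) = (\<Sum>k\<in>UNIV. ?G $ l $ k *\<^sub>R
      (\<Sum>m\<in>UNIV. ?H $ k $ m *\<^sub>R (?H ** transpose (W (axis m 1)))))" for l
    unfolding sum_matrix_mult_scaleR gram_inv sum_mat_1_scaleR ..
  then have "?H ** transpose (W (axis l 1)) = 0" for l by (simp add: *)
  then have "(?G ** ?H) ** transpose (W (axis l 1)) = 0" for l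
    by (simp only: matrix_mul_assoc[symmetric] times0_right)
  then have tW: "transpose (W (axis l 1)) = 0" for l by (simp only: gram_inv matrix_mul_lid)
  have W0: "W (axis l 1) = 0" for l
    using arg_cong[OF tW[of l], of transpose] by (simp add: transpose_def vec_eq_iff)
  have "linear W"
  proof (rule linearI)
    note N = linear_nabla_endo[OF hJ U x] and L = linear_complex_structure[OF hJ U x]
    show "W (a + b) = W a + W b" "W (c *\<^sub>R a) = c *\<^sub>R W a" for a b c
      by (simp_all add: W_def linear_add[OF N] linear_cmul[OF N] linear_add[OF L] linear_cmul[OF L]
          matrix_bilinear_simps scaleR_add_right)
  qed
  then have "W = (\<lambda>u. 0)"
    by (rule linear_eq_stdbasis[OF _ linear_zero]) (auto simp: Basis_vec_def W0)
  then have "W u = 0" by simp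
  then show ?thesis by (simp add: W_def eq_neg_iff_add_eq_0)
qed

end

section \<open>Traces and the almost complex structure\<close>

lemma bilinear_matrix_vector_mult:
  fixes N :: "'a::real_vector \<Rightarrow> real^'n^'m"
  assumes "linear N"
  shows "bilinear (\<lambda>u v. N u *v v)"
  by (auto simp: bilinear_def linear_add[OF assms] linear_cmul[OF assms] matrix_bilinear_simps
      intro!: linearI)

context
  fixes U :: "(real^'n::finite) set" and h :: "'n metric_field" and J :: "'n endo_field" and x :: "real^'n"
  assumes hJ: "almost_hermitian_on U h J" and U: "open U" and x: "x \<in> U"
begin

lemma metric_trace_complex_structure:
  assumes "bilinear K"
  shows "metric_trace (h x) (\<lambda>u v. K u (J x v)) = - metric_trace (h x) (\<lambda>u v. K (J x u) v)"
  using metric_trace_matrix_left[OF assms, of "h x" "matrix (J x)"]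
    metric_trace_matrix_right[OF assms, of "h x" "matrix (J x)"]
  by (simp add: matrix_complex_structure_vector[OF hJ U x]
      matrix_inv_gram_complex_structure[OF hJ U x] sum_negf)

text \<open>Moving \<open>J\<close> from the second argument to the first costs a sign, and
  \<open>J^2 = -1\<close> there restores it.\<close>

lemma metric_trace_complex_structure_both:
  assumes "bilinear K"
  shows "metric_trace (h x) (\<lambda>u v. K (J x u) (J x v)) = metric_trace (h x) K"
proof -
  note L = linear_complex_structure[OF hJ U x]
  have "bilinear (\<lambda>u v. K (J x u) v)"
    using assms by (auto simp: bilinear_def intro: linear_compose[OF L, unfolded comp_def])
  from metric_trace_complex_structure[OF this]
  have "metric_trace (h x) (\<lambda>u v. K (J x u) (J x v)) = - metric_trace (h x) (\<lambda>u v. K (J x (J x u)) v)" .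
  moreover have "J x (J x u) = - u" for u
    using hJ x by (simp add: almost_hermitian_on_def almost_complex_structure_on_def)
  ultimately show ?thesis
    by (simp add: bilinear_lneg[OF assms] metric_trace_def sum_negf)
qed

text \<open>Contracting with \<open>G\<close> cancels the raising of the derivative index, so the
  hypothesis says that the trace of \<open>W u *v v\<close> is zero. Its two summands differ by
  applying \<open>J\<close> to both arguments, so they have equal traces, each of which must
  vanish.\<close>

lemma nabla_endo_cosymplectic:
  assumes "tensor_trace (h x) (D2F h J x) = 0"
  shows "metric_trace (h x) (\<lambda>u v. nabla_endo h J x u *v v) = 0"
proof -
  let ?G = "gram (h x)" and ?N = "nabla_endo h J x" and ?J = "matrix (J x)"
  let ?H = "matrix_inv ?G"
  define W where "W u = ?N u + ?N (J x u) ** ?J" for u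
  have sym: "?G $ k $ i = ?G $ i $ k" for i k
    using arg_cong[OF transpose_gram[OF hermitian_metric[OF hJ U] U x], of "\<lambda>A. A $ i $ k"]
    by (simp add: transpose_def)
  have "metric_trace (h x) (\<lambda>u v. W u *v v) $ j = 0" for j
  proof -
    have "0 = (\<Sum>k\<in>UNIV. \<Sum>i\<in>UNIV. complex_of_real (?G $ k $ i) *
        complex_of_real (1/2 * (\<Sum>l\<in>UNIV. ?H $ k $ l *\<^sub>R (?H ** transpose (W (axis l 1)))) $ i $ j))"
      using arg_cong[OF assms, of "\<lambda>v. v $ j"]
      unfolding D2F_nabla_endo[OF hJ U x, folded W_def] tensor_trace_def by simp
    also have "\<dots> = complex_of_real (1/2 * (\<Sum>k\<in>UNIV. \<Sum>i\<in>UNIV. ?G $ k $ i *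
        (\<Sum>l\<in>UNIV. ?H $ k $ l *\<^sub>R (?H ** transpose (W (axis l 1)))) $ i $ j))"
      by (simp add: sum_distrib_left)
    finally have "0 = (\<Sum>k\<in>UNIV. \<Sum>i\<in>UNIV. ?G $ k $ i *
        (\<Sum>l\<in>UNIV. ?H $ k $ l *\<^sub>R (?H ** transpose (W (axis l 1)))) $ i $ j)"
      using of_real_eq_0_iff by fastforce
    \<comment> \<open>The derivative index \<open>k\<close> becomes the inner summation, so that
      \<open>G\<close> can cancel \<open>H\<close> there.\<close>
    also have "\<dots> = (\<Sum>i\<in>UNIV. \<Sum>k\<in>UNIV. ?G $ k $ i *
        (\<Sum>l\<in>UNIV. ?H $ k $ l *\<^sub>R (?H ** transpose (W (axis l 1)))) $ i $ j)"
      by (rule sum.swap)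
    also have "\<dots> = (\<Sum>i\<in>UNIV. (\<Sum>k\<in>UNIV. ?G $ i $ k *\<^sub>R
        (\<Sum>l\<in>UNIV. ?H $ k $ l *\<^sub>R (?H ** transpose (W (axis l 1))))) $ i $ j)"
      by (simp add: sym[of _ "_ :: 'n"])
    also have "\<dots> = (\<Sum>i\<in>UNIV. (?H ** transpose (W (axis i 1))) $ i $ j)"
      by (simp only: sum_matrix_mult_scaleR sum_mat_1_scaleR
          matrix_inv_right_left[OF invertible_gram[OF hermitian_metric[OF hJ U] U x]])
    also have "\<dots> = metric_trace (h x) (\<lambda>u v. W u *v v) $ j"
      by (simp add: metric_trace_def matrix_matrix_mult_def transpose_def
          matrix_vector_mult_basis column_def)
    finally show ?thesis by simp
  qed
  then have "0 = metric_trace (h x) (\<lambda>u v. W u *v v)" by (simp add: vec_eq_iff)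
  also have "\<dots> = metric_trace (h x) (\<lambda>u v. ?N u *v v) +
      metric_trace (h x) (\<lambda>u v. ?N (J x u) *v J x v)"
    by (simp only: W_def matrix_bilinear_simps matrix_vector_mul_assoc[symmetric]
        matrix_complex_structure_vector[OF hJ U x] metric_trace_add)
  also have "metric_trace (h x) (\<lambda>u v. ?N (J x u) *v J x v) = metric_trace (h x) (\<lambda>u v. ?N u *v v)"
    by (rule metric_trace_complex_structure_both[OF
          bilinear_matrix_vector_mult[OF linear_nabla_endo[OF hJ U x]]])
  finally have "2 *\<^sub>R metric_trace (h x) (\<lambda>u v. ?N u *v v) = 0" by (simp only: scaleR_2)
  then show ?thesis by simp
qed

end

section \<open>Holomorphic maps\<close>

lemma holomorphic_tension_field_0:
  fixes f :: "real^'n::finite \<Rightarrow> real^'m::finite"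
  assumes gJ: "almost_hermitian_on U g J" and U: "open U" and x: "x \<in> U"
    and hI: "almost_hermitian_on V h I" and V: "open V"
    and f: "smooth_on U f" and fUV: "f ` U \<subseteq> V"
    and hol: "\<And>y u. y \<in> U \<Longrightarrow>
      frechet_derivative f (at y) (J y u) = I (f y) (frechet_derivative f (at y) u)"
    and cosymp: "cosymplectic_on U g J" and symp: "symplectic12_on V h I"
  shows "tension_field g h f x = 0"
proof -
  let ?J = "matrix (J x)" and ?I = "matrix (I (f x))" and ?f' = "frechet_derivative f (at x)"
    and ?NJ = "nabla_endo g J x" and ?NI = "nabla_endo h I (f x)"
    and ?tr = "metric_trace (g x) :: (real^'n \<Rightarrow> real^'n \<Rightarrow> real^'m) \<Rightarrow> real^'m"
    and ?dJ = "frechet_derivative (\<lambda>y. matrix (J y)) (at x)"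
    and ?dI = "frechet_derivative (\<lambda>y. matrix (I y)) (at (f x))"
    and ?\<Gamma>g = "\<lambda>u. matrix (christoffel g x u)"
    and ?\<Gamma>h = "\<lambda>u. matrix (christoffel h (f x) u)"
  have fx: "f y \<in> V" if "y \<in> U" for y using fUV that by blast
  have C2: "Ck_on (Suc (Suc 0)) U f" using f by (simp only: smooth_on_def)
  have df: "(f has_derivative frechet_derivative f (at y)) (at y)" if "y \<in> U" for y
    using C2 that by (simp add: frechet_derivative_works)
  have ddf: "((\<lambda>y. frechet_derivative f (at y) v) has_derivative
      frechet_derivative (\<lambda>y. frechet_derivative f (at y) v) (at x)) (at x)" for v
    using C2 x by (simp add: frechet_derivative_works)
  \<comment> \<open>The Jacobian matrix of \<open>f\<close> and its derivative \<open>D\<close>, so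
    that holomorphy becomes the matrix identity \<open>A J = I A\<close> and can be differentiated
    by the product rule.\<close>
  define A where "A y = matrix (frechet_derivative f (at y))" for y
  have A: "A y *v v = frechet_derivative f (at y) v" if "y \<in> U" for y v
    using has_derivative_linear[OF df[OF that]] by (simp add: A_def matrix_works)
  define D where "D u = (\<chi> i j. frechet_derivative (\<lambda>y. frechet_derivative f (at y) (axis j 1)) (at x) u $ i)" for u
  have dA: "(A has_derivative D) (at x)"
    unfolding A_def[abs_def] D_def[abs_def] by (rule has_derivative_matrix) (rule ddf)
  have D: "frechet_derivative (\<lambda>y. frechet_derivative f (at y) v) (at x) u = D u *v v" for u v
  proof -
    have "((\<lambda>y. A y *v v) has_derivative (\<lambda>u. D u *v v)) (at x)"
      by (rule bounded_linear.has_derivative[OF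
            bounded_bilinear.bounded_linear_left[OF bounded_bilinear_matrix_vector_mult] dA])
    then have "((\<lambda>y. frechet_derivative f (at y) v) has_derivative (\<lambda>u. D u *v v)) (at x)"
      by (rule has_derivative_transform_within_open[OF _ U x]) (simp only: A)
    from has_derivative_unique[OF ddf this] show ?thesis by simp
  qed
  note gR = hermitian_metric[OF gJ U] and hR = hermitian_metric[OF hI V]
  note Jv = matrix_complex_structure_vector[OF gJ U x]
    and Iv = matrix_complex_structure_vector[OF hI V fx[OF x]]
  have \<Gamma>g: "?\<Gamma>g u *v v = christoffel g x u v" for u v
    using bilinear_christoffel[OF gR U x] by (simp add: bilinear_def matrix_works)
  have \<Gamma>h: "?\<Gamma>h u *v v = christoffel h (f x) u v" for u v
    using bilinear_christoffel[OF hR V fx[OF x]] by (simp add: bilinear_def matrix_works)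
  \<comment> \<open>The covariant derivative of \<open>df\<close> as a section of
    \<open>Hom(TU, f^*TV)\<close>: the target connection acts on the left of \<open>A\<close>, the
    source connection on the right.\<close>
  define B where "B u = D u + ?\<Gamma>h (?f' u) ** A x - A x ** ?\<Gamma>g u" for u
  have B: "second_fundamental_form g h f x u v = B u *v v" for u v
    by (simp only: second_fundamental_form_def B_def D matrix_bilinear_simps
        matrix_vector_mul_assoc[symmetric] A[OF x] \<Gamma>g \<Gamma>h)
  \<comment> \<open>Second partial derivatives commute and both connections are
    torsion-free.\<close>
  have sym: "B u *v v = B v *v u" for u v
    unfolding B[symmetric] second_fundamental_form_def
    using second_derivative_symmetric[OF U x C2, of u v] christoffel_sym[OF gR U x, of u v]
      christoffel_sym[OF hR V fx[OF x], of "?f' u" "?f' v"] by simp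
  \<comment> \<open>Linearity in the derivative slot is inherited from the other slot through
    symmetry.\<close>
  have "linear (\<lambda>v. B v *v u)" for u
    unfolding sym[of _ u] by simp
  then have bilB: "bilinear (\<lambda>u v. B u *v v)" by (simp add: bilinear_def)

  have AJ: "A y ** matrix (J y) = matrix (I (f y)) ** A y" if "y \<in> U" for y
    using that
    by (simp add: matrix_eq matrix_vector_mul_assoc[symmetric] A hol
        matrix_complex_structure_vector[OF gJ U] matrix_complex_structure_vector[OF hI V fx])
  have 1: "((\<lambda>y. A y ** matrix (J y)) has_derivative (\<lambda>u. A x ** ?dJ u + D u ** ?J)) (at x)"
    by (rule bounded_bilinear.FDERIV[OF bounded_bilinear_matrix_mult dA
          has_derivative_complex_structure[OF gJ U x]])
  have dIf: "((\<lambda>y. matrix (I (f y))) has_derivative (\<lambda>u. ?dI (?f' u))) (at x)"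
    by (rule has_derivative_compose[OF df[OF x] has_derivative_complex_structure[OF hI V fx[OF x]]])
  have "((\<lambda>y. matrix (I (f y)) ** A y) has_derivative (\<lambda>u. ?I ** D u + ?dI (?f' u) ** A x)) (at x)"
    by (rule bounded_bilinear.FDERIV[OF bounded_bilinear_matrix_mult dIf dA])
  \<comment> \<open>The same function as in \<open>1\<close>, now differentiated as
    \<open>I(f y) A y\<close>; uniqueness of derivatives equates the two results.\<close>
  then have 2: "((\<lambda>y. A y ** matrix (J y)) has_derivative (\<lambda>u. ?I ** D u + ?dI (?f' u) ** A x)) (at x)"
    by (rule has_derivative_transform_within_open[OF _ U x]) (simp only: AJ)
  have D_J: "A x ** ?dJ u + D u ** ?J = ?I ** D u + ?dI (?f' u) ** A x" for u
    using fun_cong[OF has_derivative_unique[OF 1 2], of u] .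
  \<comment> \<open>Adding the Christoffel terms makes \<open>D_J\<close> covariant. The remaining
    source term \<open>- I A \<Gamma>\<close> cancels against \<open>A J \<Gamma>\<close> because
    \<open>A J = I A\<close>.\<close>
  have B_J: "B u ** ?J = ?I ** B u + ?NI (?f' u) ** A x - A x ** ?NJ u" for u
  proof -
    have "D u ** ?J = ?I ** D u + ?dI (?f' u) ** A x - A x ** ?dJ u"
      using D_J[of u] by (simp add: algebra_simps)
    moreover have "M ** A x ** ?J = M ** ?I ** A x" for M :: "real^'m^'m"
      by (simp only: matrix_mul_assoc[symmetric] AJ[OF x])
    ultimately show ?thesis
      by (simp add: B_def nabla_endo_def matrix_bilinear_simps matrix_mul_assoc AJ[OF x])
  qed

  \<comment> \<open>Skewness of \<open>J\<close> changes the sign, whereas symmetry of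
    \<open>B\<close> and of the trace brings the original expression back; so the trace equals its
    negative.\<close>
  have "?tr (\<lambda>u v. B u *v J x v) = - ?tr (\<lambda>u v. B (J x u) *v v)"
    by (rule metric_trace_complex_structure[OF gJ U x bilB])
  also have "?tr (\<lambda>u v. B (J x u) *v v) = ?tr (\<lambda>u v. B v *v J x u)" by (simp only: sym)
  also have "\<dots> = ?tr (\<lambda>u v. B u *v J x v)"
    by (rule metric_trace_swap[OF transpose_matrix_inv_gram[OF gR U x]])
  finally have "?tr (\<lambda>u v. B u *v J x v) = 0" by (simp add: eq_neg_iff_add_eq_0 flip: scaleR_2)
  moreover have "B u *v J x v = ?I *v (B u *v v) + (?NI (?f' u) *v ?f' v + A x *v (- (?NJ u *v v)))" for u v
  proof -
    have "B u *v J x v = (B u ** ?J) *v v" by (simp only: Jv matrix_vector_mul_assoc[symmetric])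
    then show ?thesis
      by (simp add: B_J matrix_bilinear_simps matrix_vector_mul_assoc[symmetric] A[OF x])
  qed
  moreover have "?tr (\<lambda>u v. ?I *v (B u *v v)) = ?I *v ?tr (\<lambda>u v. B u *v v)"
    by (rule metric_trace_linear) simp
  moreover have "?tr (\<lambda>u v. A x *v (- (?NJ u *v v))) = 0"
  proof -
    have "linear (\<lambda>w. A x *v (- w))"
      by (rule linearI) (simp_all add: matrix_bilinear_simps)
    from metric_trace_linear[OF this, of "g x" "\<lambda>u v. ?NJ u *v v"]
    show ?thesis
      using nabla_endo_cosymplectic[OF gJ U x] cosymp x by (simp add: cosymplectic_on_def)
  qed
  moreover have "?tr (\<lambda>u v. ?NI (?f' u) *v ?f' v) = 0"
  proof -
    have lin: "linear (\<lambda>u. ?NI (?f' u))"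
      using linear_compose[OF has_derivative_linear[OF df[OF x]] linear_nabla_endo[OF hI V fx[OF x]]]
      by (simp add: comp_def)
    have bil: "bilinear (\<lambda>u v. ?NI (?f' u) *v ?f' v)"
      using bilinear_matrix_vector_mult[of "\<lambda>u. ?NI (?f' u) ** A x"] linear_add[OF lin] linear_cmul[OF lin]
      by (simp add: linear_iff matrix_bilinear_simps matrix_vector_mul_assoc[symmetric] A[OF x])
    have "D2F h I (f x) = 0" using symp fx[OF x] by (simp add: symplectic12_on_def)
    note NI = nabla_endo_symplectic12[OF hI V fx[OF x] this]
    \<comment> \<open>Inserting \<open>J\<close> in both source arguments inserts \<open>I\<close>
      after \<open>df\<close> by holomorphy. The (1,2)-symplectic identity then reverses the sign of
      the integrand, although its trace is unchanged.\<close>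
    have "?tr (\<lambda>u v. ?NI (?f' u) *v ?f' v) = ?tr (\<lambda>u v. ?NI (?f' (J x u)) *v ?f' (J x v))"
      by (rule metric_trace_complex_structure_both[OF gJ U x bil, symmetric])
    also have "\<dots> = ?tr (\<lambda>u v. - (?NI (?f' u) *v ?f' v))"
    proof -
      have "?NI (?f' (J x u)) *v ?f' (J x v) = - (?NI (?f' u) *v ?f' v)" for u v
        by (subst (2) NI) (simp add: matrix_bilinear_simps matrix_vector_mul_assoc[symmetric] hol[OF x] Iv)
      then show ?thesis by simp
    qed
    also have "\<dots> = - ?tr (\<lambda>u v. ?NI (?f' u) *v ?f' v)"
      by (simp add: metric_trace_def sum_negf)
    finally show ?thesis by (simp add: eq_neg_iff_add_eq_0 flip: scaleR_2)
  qed
  ultimately have "?I *v ?tr (\<lambda>u v. B u *v v) = 0" by (simp add: metric_trace_add)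
  \<comment> \<open>A second application of \<open>I\<close> produces \<open>- mat 1\<close>, which
    removes \<open>I\<close> from the equation.\<close>
  then have "(?I ** ?I) *v ?tr (\<lambda>u v. B u *v v) = 0"
    by (simp only: matrix_vector_mul_assoc[symmetric] matrix_vector_mult_0_right)
  then have "?tr (\<lambda>u v. B u *v v) = 0"
    by (simp add: matrix_complex_structure_square[OF hI V fx[OF x]] matrix_bilinear_simps)
  then show ?thesis unfolding tension_field_def B[symmetric] .
qed

text \<open>Harmonicity is a condition on each chosen lift, and the atlases supply open domains
  carrying the required structures, so \<open>holomorphic_tension_field_0\<close> applies to every
  lift.\<close>

theorem theorem6p4:
  fixes X :: "'a topology" and \<A> :: "('a, 'n::finite) orbifold_chart set"
    and gX :: "('a, 'n) orbifold_chart \<Rightarrow> 'n metric_field"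
    and JX :: "('a, 'n) orbifold_chart \<Rightarrow> 'n endo_field"
    and Y :: "'b topology" and \<B> :: "('b, 'm::finite) orbifold_chart set"
    and gY :: "('b, 'm) orbifold_chart \<Rightarrow> 'm metric_field"
    and JY :: "('b, 'm) orbifold_chart \<Rightarrow> 'm endo_field"
    and \<phi> :: "'a \<Rightarrow> 'b" and L :: "'a \<Rightarrow> ('a, 'n, 'b, 'm) local_lift"
  assumes "almost_hermitian_orbifold X \<A> gX JX"
    and "almost_hermitian_orbifold Y \<B> gY JY"
    and "cosymplectic_orbifold X \<A> gX JX"
    and "symplectic12_orbifold Y \<B> gY JY"
    and "complete_orbifold_map X \<A> Y \<B> \<phi> L"
    and "holomorphic_orbifold_map X JX JY L"
  shows "harmonic_orbifold_map X gX gY L"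
  unfolding harmonic_orbifold_map_def Let_def
proof (intro ballI)
  fix p x
  assume p: "p \<in> topspace X" and x: "x \<in> chart_dom (lift_source (L p))"
  let ?C = "lift_source (L p)" and ?D = "lift_target (L p)"
  have lift: "local_lift \<A> \<B> \<phi> (L p)" using assms(5) p by (simp add: complete_orbifold_map_def)
  then have C: "?C \<in> \<A>" and D: "?D \<in> \<B>" by (simp_all add: local_lift_def)
  have "orbifold X \<A>" "orbifold Y \<B>"
    using assms(1,2) by (simp_all add: almost_hermitian_orbifold_def riemannian_orbifold_def)
  then have opens: "open (chart_dom ?C)" "open (chart_dom ?D)"
    using C D by (simp_all add: orbifold_def orbifold_atlas_def orbifold_chart_def)
  show "tension_field (gX ?C) (gY ?D) (lift_map (L p)) x = 0"
  proof (rule holomorphic_tension_field_0[OF _ opens(1) x _ opens(2)])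
    show "almost_hermitian_on (chart_dom ?C) (gX ?C) (JX ?C)"
      and "almost_hermitian_on (chart_dom ?D) (gY ?D) (JY ?D)"
      using assms(1,2) C D by (simp_all add: almost_hermitian_orbifold_def)
    show "smooth_on (chart_dom ?C) (lift_map (L p))"
      and "lift_map (L p) ` chart_dom ?C \<subseteq> chart_dom ?D"
      using lift by (simp_all add: local_lift_def)
    show "cosymplectic_on (chart_dom ?C) (gX ?C) (JX ?C)"
      using assms(3) C by (simp add: cosymplectic_orbifold_def)
    show "symplectic12_on (chart_dom ?D) (gY ?D) (JY ?D)"
      using assms(4) D by (simp add: symplectic12_orbifold_def)
    show "frechet_derivative (lift_map (L p)) (at y) (JX ?C y u) =
        JY ?D (lift_map (L p) y) (frechet_derivative (lift_map (L p)) (at y) u)"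
      if "y \<in> chart_dom ?C" for y u
      using assms(6) p that by (simp add: holomorphic_orbifold_map_def Let_def)
  qed
qed

end
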